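(* Let $\Phi$ be a non-autonomous finite conformal iterated function system satisfying the open set condition, and let $E\subset\mathbb{R}^d$ be its non-autonomous finite conformal set. Suppose that $$\lim_{k\to+\infty}\frac{\log \underline c_k}{\log M_k}=0 .$$ Then the packing dimension and the upper box dimension of $E$ are given by $$\dim_{\rm P}E=\overline{\dim}_{\rm B}E=s^* .$$
   Context: Words. $\{I_k\}_{k\ge 1}$ is a sequence of index sets with $2\le \#I_k<\infty$. For $k\ge l\ge 1$, $\Sigma_l^k=\{u_l\cdots u_k: u_j\in I_j\}$; $\Sigma^k=\Sigma_1^k$, $\Sigma^0=\{\emptyset\}$, $\Sigma^*=\bigcup_{k\ge 0}\Sigma^k$. System. $J\subset\mathbb R^d$ is compact with non-empty interior and $\overline{\mathrm{int}(J)}=J$. For each $k\ge1$, $\Phi_k=\{\varphi_{k,i}\}_{i\in I_k}$ is a family of maps $\varphi_{k,i}:J\to J$. For $\mathbf u=u_l\cdots u_k\in\Sigma_l^k$, $\varphi_{\mathbf u}=\varphi_{l,u_l}\circ\cdots\circ\varphi_{k,u_k}$ (and $\varphi_\emptyset=\mathrm{id}$). $\Phi=\{\Phi_k\}_{k\ge1}$, together with a family $\{J_{\mathbf u}:\mathbf u\in\Sigma^*\}$ of closed subsets of $J$, is a non-autonomous finite iterated function system if: (i) there is $0<c<1$ with $|\varphi_{k,i}(x)-\varphi_{k,i}(y)|\le c|x-y|$ for all $k$, $i\in I_k$, $x,y\in J$; (ii) $J_\emptyset=J$ and $J_{\mathbf u i}\subset J_{\mathbf u}$ for all $\mathbf u\in\Sigma^{k-1}$,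 $i\in I_k$, $k\ge1$; (iii) for each $\mathbf u\in\Sigma^*$ there is $\omega_{\mathbf u}\in\mathbb R^d$ such that $J_{\mathbf u}=\Psi_{\mathbf u}(J)$ with $\Psi_{\mathbf u}=\varphi_{\mathbf u}+\omega_{\mathbf u}$. Its attractor is $E=\bigcap_{k\ge1}\bigcup_{\mathbf u\in\Sigma^k}J_{\mathbf u}$. The open set condition (OSC) means: for all $k\ge0$, $\mathbf u\in\Sigma^k$ and $i\ne j\in I_{k+1}$, $\mathrm{int}(J_{\mathbf ui})\cap\mathrm{int}(J_{\mathbf uj})=\emptyset$. Conformality. $\Phi$ is conformal (and $E$ is called a non-autonomous finite conformal set) if there is an open connected set $V\supset J$, independent of $k$, such that each $\varphi_{k,j}$ extends to a $C^1$ conformal diffeomorphism of $V$ into $V$ (the derivative at each point is a similarity linear map), and there is $C\ge1$ with $\|D\varphi_{\mathbf u}(x)\|\le C\|D\varphi_{\mathbf u}(y)\|$ for all $x,y\in V$ and all $\mathbf u\in\Sigma_l^k$, $k\ge l\ge1$. Here $\|D\varphi(x)\|$ is the scaling factor of $D\varphi(x)$ and $\|D\varphi\|=\sup_{x\in J}\|D\varphi(x)\|$. Put $M_k=\sup_{\mathbf u\in\Sigma^k}\|D\varphi_{\mathbf u}\|$ and $\underline c_k=\inf_{j\in I_k}\|D\varphi_{k,j}\|$. Upper pressure: $\overline P(t)=\limsup_{k\to\infty}\frac1k\log\sum_{\mathbf u\in\Sigma^k}\|D\varphi_{\mathbf u}\|^t$, and $s^*=\inf\{t:\overline P(t)<0\}=\sup\{t:\overline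 P(t)>0\}$. *)

theory Defs
  imports "HOL-Analysis.Analysis"
begin

text \<open>
  Minimal number of sets of diameter at most \<open>\<delta>\<close> covering \<open>E\<close>, for bounded \<open>E\<close>. Boundedness of
  the covering sets is explicit because \<^const>\<open>diameter\<close> is meaningless on unbounded sets.
\<close>

definition covering_number :: "'a::metric_space set \<Rightarrow> real \<Rightarrow> nat" where
  "covering_number E \<delta> =
     (LEAST n. \<exists>\<U>. finite \<U> \<and> card \<U> = n \<and> (\<forall>A\<in>\<U>. bounded A \<and> diameter A \<le> \<delta>) \<and> E \<subseteq> \<Union>\<U>)"

definition upper_box_dim :: "'a::metric_space set \<Rightarrow> ereal" where
  "upper_box_dim E =
     Limsup (at_right 0) (\<lambda>\<delta>. ereal (ln (real (covering_number E \<delta>)) / - ln \<delta>))"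

text \<open>
  A \<open>\<delta>\<close>-packing of \<open>F\<close> is a countable set of pairs (centre, radius) describing pairwise disjoint
  closed balls.
\<close>

definition packings :: "real \<Rightarrow> 'a::metric_space set \<Rightarrow> ('a \<times> real) set set" where
  "packings \<delta> F =
     {B. countable B \<and> (\<forall>(x, r)\<in>B. x \<in> F \<and> 0 < r \<and> r \<le> \<delta>) \<and>
         disjoint_family_on (\<lambda>(x, r). cball x r) B}"

definition packing_delta :: "real \<Rightarrow> real \<Rightarrow> 'a::metric_space set \<Rightarrow> ennreal" where
  "packing_delta s \<delta> F =
     (SUP B\<in>packings \<delta> F. \<Sum>\<^sub>\<infinity>(x, r)\<in>B. ennreal (diameter (cball x r) powr s))"

text \<open>
  \<^term>\<open>packing_delta s \<delta> F\<close> is nondecreasing in \<open>\<delta>\<close>, so its limit as \<open>\<delta>\<close> tends to \<open>0\<close> from the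
  right is the infimum.
\<close>

definition packing_premeasure :: "real \<Rightarrow> 'a::metric_space set \<Rightarrow> ennreal" where
  "packing_premeasure s F = (INF \<delta>\<in>{0<..}. packing_delta s \<delta> F)"

definition packing_measure :: "real \<Rightarrow> 'a::metric_space set \<Rightarrow> ennreal" where
  "packing_measure s E =
     (INF F\<in>{F :: nat \<Rightarrow> 'a set. E \<subseteq> (\<Union>i. F i)}. \<Sum>i. packing_premeasure s (F i))"

definition packing_dim :: "'a::metric_space set \<Rightarrow> ereal" where
  "packing_dim E = Inf {ereal s | s. 0 \<le> s \<and> packing_measure s E = 0}"

text \<open>
  \<^term>\<open>words I l k\<close> is the set of words \<open>u\<^sub>l \<dots> u\<^sub>k\<close>, stored as lists whose entry at position \<open>j\<close>
  is \<open>u\<^sub>l\<^sub>+\<^sub>j\<close>; in particular \<^term>\<open>words I 1 0 = {[]}\<close>. A list does not record its starting level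
  \<open>l\<close>, which is therefore an argument of \<open>word_map\<close>.
\<close>

definition words :: "(nat \<Rightarrow> 'i set) \<Rightarrow> nat \<Rightarrow> nat \<Rightarrow> 'i list set" where
  "words I l k = {u. length u = Suc k - l \<and> (\<forall>j<length u. u ! j \<in> I (l + j))}"

fun word_map :: "(nat \<Rightarrow> 'i \<Rightarrow> 'a \<Rightarrow> 'a) \<Rightarrow> nat \<Rightarrow> 'i list \<Rightarrow> 'a \<Rightarrow> 'a" where
  "word_map \<phi> l [] = id"
| "word_map \<phi> l (i # u) = \<phi> l i \<circ> word_map \<phi> (Suc l) u"

text \<open>
  Only the values of \<open>\<phi> k i\<close> on \<open>J\<close> for \<open>k \<ge> 1\<close> and \<open>i \<in> I k\<close>, and the sets \<open>Js u\<close> for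
  \<open>u \<in> words I 1 k\<close>, are relevant.
\<close>

locale nonautonomous_ifs =
  fixes I :: "nat \<Rightarrow> 'i set"
    and J :: "'a::euclidean_space set"
    and \<phi> :: "nat \<Rightarrow> 'i \<Rightarrow> 'a \<Rightarrow> 'a"
    and Js :: "'i list \<Rightarrow> 'a set"
  assumes index_finite: "k \<ge> 1 \<Longrightarrow> finite (I k)"
    and index_card: "k \<ge> 1 \<Longrightarrow> 2 \<le> card (I k)"
    and J_compact: "compact J"
    and J_interior: "interior J \<noteq> {}"
    and J_regular: "closure (interior J) = J"
    and maps_into: "\<lbrakk>k \<ge> 1; i \<in> I k\<rbrakk> \<Longrightarrow> \<phi> k i ` J \<subseteq> J"
    and contraction: "\<exists>c. 0 < c \<and> c < 1 \<and>
          (\<forall>k\<ge>1. \<forall>i\<in>I k. \<forall>x\<in>J. \<forall>y\<in>J. norm (\<phi> k i x - \<phi> k i y) \<le> c * norm (x - y))"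
    and Js_closed: "u \<in> words I 1 k \<Longrightarrow> closed (Js u)"
    and Js_subset: "u \<in> words I 1 k \<Longrightarrow> Js u \<subseteq> J"
    and Js_Nil: "Js [] = J"
    and Js_nested: "\<lbrakk>k \<ge> 1; u \<in> words I 1 (k - 1); i \<in> I k\<rbrakk> \<Longrightarrow> Js (u @ [i]) \<subseteq> Js u"
    and Js_translate: "u \<in> words I 1 k \<Longrightarrow> \<exists>\<omega>. Js u = (\<lambda>x. word_map \<phi> 1 u x + \<omega>) ` J"

definition attractor :: "(nat \<Rightarrow> 'i set) \<Rightarrow> ('i list \<Rightarrow> 'a set) \<Rightarrow> 'a set" where
  "attractor I Js = (\<Inter>k\<in>{1..}. \<Union>u\<in>words I 1 k. Js u)"

definition open_set_condition ::
    "(nat \<Rightarrow> 'i set) \<Rightarrow> ('i list \<Rightarrow> 'a::topological_space set) \<Rightarrow> bool" where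
  "open_set_condition I Js \<longleftrightarrow>
     (\<forall>k. \<forall>u\<in>words I 1 k. \<forall>i\<in>I (Suc k). \<forall>j\<in>I (Suc k). i \<noteq> j \<longrightarrow>
        interior (Js (u @ [i])) \<inter> interior (Js (u @ [j])) = {})"

definition C1_on :: "'a::euclidean_space set \<Rightarrow> ('a \<Rightarrow> 'a) \<Rightarrow> bool" where
  "C1_on S f \<longleftrightarrow>
     (\<exists>f' :: 'a \<Rightarrow> 'a \<Rightarrow>\<^sub>L 'a. continuous_on S f' \<and>
        (\<forall>x\<in>S. (f has_derivative blinfun_apply (f' x)) (at x)))"

definition similarity_linear :: "('a::euclidean_space \<Rightarrow> 'a) \<Rightarrow> bool" where
  "similarity_linear A \<longleftrightarrow> linear A \<and> (\<exists>r>0. \<forall>v. norm (A v) = r * norm v)"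

definition conformal_diffeo_into :: "'a::euclidean_space set \<Rightarrow> ('a \<Rightarrow> 'a) \<Rightarrow> bool" where
  "conformal_diffeo_into V f \<longleftrightarrow>
     f ` V \<subseteq> V \<and> inj_on f V \<and> open (f ` V) \<and> C1_on V f \<and> C1_on (f ` V) (inv_into V f) \<and>
     (\<forall>x\<in>V. similarity_linear (frechet_derivative f (at x)))"

definition deriv_norm :: "('a::euclidean_space \<Rightarrow> 'a) \<Rightarrow> 'a \<Rightarrow> real" where
  "deriv_norm f x = onorm (frechet_derivative f (at x))"

text \<open>For a similarity, the operator norm is the scaling factor.\<close>

lemma onorm_eq_scaling_factor:
  fixes A :: "'a::euclidean_space \<Rightarrow> 'a"
  assumes "\<And>v. norm (A v) = r * norm v"
  shows "onorm A = r"
proof -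
  have "norm (A v) / norm v = (if v = 0 then 0 else r)" for v
    by (simp add: assms)
  moreover obtain b :: 'a where "b \<in> Basis" using nonempty_Basis by blast
  moreover from this have "r \<ge> 0"
    using assms[of b] norm_ge_zero[of "A b"] by simp
  moreover have "(if b = 0 then 0 else r) = r"
    using \<open>b \<in> Basis\<close> by auto
  ultimately show ?thesis
    unfolding onorm_def
    by (intro cSup_eq_maximum) (auto intro!: image_eqI[where x = b])
qed

text \<open>
  \<open>\<psi>\<close> collects the extensions of the maps \<open>\<phi> k i\<close> from \<open>J\<close> to \<open>V\<close>. The derivatives of the system
  on \<open>J\<close>, boundary points included, are those of \<open>\<psi>\<close>.
\<close>

definition conformal_extension ::
    "(nat \<Rightarrow> 'i set) \<Rightarrow> 'a::euclidean_space set \<Rightarrow> (nat \<Rightarrow> 'i \<Rightarrow> 'a \<Rightarrow> 'a) \<Rightarrow>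
     'a set \<Rightarrow> (nat \<Rightarrow> 'i \<Rightarrow> 'a \<Rightarrow> 'a) \<Rightarrow> bool" where
  "conformal_extension I J \<phi> V \<psi> \<longleftrightarrow>
     open V \<and> connected V \<and> J \<subseteq> V \<and>
     (\<forall>k\<ge>1. \<forall>i\<in>I k. (\<forall>x\<in>J. \<psi> k i x = \<phi> k i x) \<and> conformal_diffeo_into V (\<psi> k i)) \<and>
     (\<exists>C\<ge>1. \<forall>l\<ge>1. \<forall>k\<ge>l. \<forall>u\<in>words I l k. \<forall>x\<in>V. \<forall>y\<in>V.
        deriv_norm (word_map \<psi> l u) x \<le> C * deriv_norm (word_map \<psi> l u) y)"

definition sup_deriv_norm :: "'a::euclidean_space set \<Rightarrow> ('a \<Rightarrow> 'a) \<Rightarrow> real" where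
  "sup_deriv_norm J f = (SUP x\<in>J. deriv_norm f x)"

definition max_ratio ::
    "(nat \<Rightarrow> 'i set) \<Rightarrow> 'a::euclidean_space set \<Rightarrow> (nat \<Rightarrow> 'i \<Rightarrow> 'a \<Rightarrow> 'a) \<Rightarrow> nat \<Rightarrow> real" where
  "max_ratio I J \<psi> k = (SUP u\<in>words I 1 k. sup_deriv_norm J (word_map \<psi> 1 u))"

definition min_level_ratio ::
    "(nat \<Rightarrow> 'i set) \<Rightarrow> 'a::euclidean_space set \<Rightarrow> (nat \<Rightarrow> 'i \<Rightarrow> 'a \<Rightarrow> 'a) \<Rightarrow> nat \<Rightarrow> real" where
  "min_level_ratio I J \<psi> k = (INF j\<in>I k. sup_deriv_norm J (\<psi> k j))"

text \<open>The upper pressure may take the values \<open>\<infinity>\<close> and \<open>-\<infinity>\<close>.\<close>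

definition upper_pressure ::
    "(nat \<Rightarrow> 'i set) \<Rightarrow> 'a::euclidean_space set \<Rightarrow> (nat \<Rightarrow> 'i \<Rightarrow> 'a \<Rightarrow> 'a) \<Rightarrow> real \<Rightarrow> ereal" where
  "upper_pressure I J \<psi> t =
     limsup (\<lambda>k. ereal (1 / real k *
       ln (\<Sum>u\<in>words I 1 k. sup_deriv_norm J (word_map \<psi> 1 u) powr t)))"

definition pressure_zero ::
    "(nat \<Rightarrow> 'i set) \<Rightarrow> 'a::euclidean_space set \<Rightarrow> (nat \<Rightarrow> 'i \<Rightarrow> 'a \<Rightarrow> 'a) \<Rightarrow> ereal" where
  "pressure_zero I J \<psi> = Inf {ereal t | t. upper_pressure I J \<psi> t < 0}"

end

theory Submission
  imports Defs
begin

text \<open>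
  Write \<open>r u\<close> for the supremum over \<open>J\<close> of the scaling factor of the map of a word \<open>u\<close>, and \<open>S k t\<close> for the
  sum of \<open>r u powr t\<close> over the words of level \<open>k\<close>. Bounded distortion makes \<open>r\<close> multiplicative up to a
  constant and turns each cylinder \<open>Js u\<close> into a set of size \<open>r u\<close>: its diameter is at most \<open>L * r u\<close>
  (\<open>cylinder_diameter\<close>) and it contains a ball of radius \<open>b * r u\<close> (\<open>cylinder_inner_ball\<close>). The theorem
  follows from a cycle of three inequalities.

  The packing dimension of a bounded set is at most its upper box dimension
  (\<open>packing_dim_le_upper_box_dim\<close>), since a packing by balls of comparable radius has no more members than a
  cover at that scale.

  If the pressure at \<open>t\<close> is negative, then \<open>S k t\<close> is summable over \<open>k\<close>. The words at which \<open>r\<close> first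
  drops to \<open>\<delta>\<close> or below give a cover of the attractor at scale \<open>\<delta>\<close>. The hypothesis on the ratio of logarithms
  ensures that their \<open>r\<close> is at least \<open>\<delta>\<close> up to a small loss in the exponent, so summability bounds
  their number by a power of \<open>\<delta>\<close> with exponent close to \<open>-t\<close> (\<open>upper_box_dim_le_pressure_zero\<close>).

  If \<open>t\<close> is below the zero of the pressure, then \<open>S k t\<close> is unbounded, and by near multiplicativity so is its part
  over the words that extend one fixed word. A pigeonhole over dyadic scales gives many such words of the
  same level and of comparable \<open>r\<close>. By the open set condition their inner balls are disjoint, hence the attractor
  has many separated points near any of its points (\<open>attractor_separated_points\<close>). Baire's theorem
  turns this local abundance into a lower bound on the packing dimension (\<open>packing_measure_nonzeroI\<close>,
  \<open>pressure_zero_le_packing_dim\<close>).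
\<close>

section \<open>Covering numbers and dyadic counting\<close>

lemma covering_number_le:
  assumes "finite \<U>" "\<And>A. A \<in> \<U> \<Longrightarrow> bounded A \<and> diameter A \<le> \<delta>" "E \<subseteq> \<Union>\<U>"
  shows "covering_number E \<delta> \<le> card \<U>"
  unfolding covering_number_def using assms by (intro Least_le) blast

lemma covering_number_attained:
  fixes E :: "'a::heine_borel set"
  assumes "bounded E" "\<delta> > 0"
  obtains \<U> where "finite \<U>" "card \<U> = covering_number E \<delta>"
    "\<And>A. A \<in> \<U> \<Longrightarrow> bounded A \<and> diameter A \<le> \<delta>" "E \<subseteq> \<Union>\<U>"
proof -
  let ?P = "\<lambda>n \<U>. finite \<U> \<and> card \<U> = n \<and> (\<forall>A\<in>\<U>. bounded A \<and> diameter A \<le> \<delta>) \<and> E \<subseteq> \<Union>\<U>"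
  have "compact (closure E)" using assms(1) by simp
  moreover have "closure E \<subseteq> (\<Union>x\<in>closure E. ball x (\<delta>/2))"
    using assms(2) by (auto intro: centre_in_ball[THEN iffD2])
  ultimately obtain X where X: "X \<subseteq> closure E" "finite X" "closure E \<subseteq> (\<Union>x\<in>X. ball x (\<delta>/2))"
    using compactE_image[of "closure E" "closure E" "\<lambda>x. ball x (\<delta>/2)"] by (metis open_ball)
  have "diameter (ball x (\<delta>/2)) \<le> \<delta>" for x :: 'a
    unfolding diameter_def using assms(2)
    by (auto intro!: cSUP_least dist_triangle_half_l[of _ _ \<delta>, THEN less_imp_le]
             simp: dist_commute case_prod_unfold)
  then have "?P (card ((\<lambda>x. ball x (\<delta>/2)) ` X)) ((\<lambda>x. ball x (\<delta>/2)) ` X)"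
    using X closure_subset[of E] by auto
  then have "\<exists>n. \<exists>\<U>. ?P n \<U>" by blast
  then have "\<exists>\<U>. ?P (LEAST n. \<exists>\<U>. ?P n \<U>) \<U>" by (rule LeastI_ex)
  then show thesis using that unfolding covering_number_def by blast
qed

lemma eventually_at_right_0:
  "eventually P (at_right (0::real)) \<longleftrightarrow> (\<exists>b>0. \<forall>x. 0 < x \<and> x < b \<longrightarrow> P x)"
  by (subst eventually_at_right[of 0 1]) auto

lemma upper_box_dim_leI:
  fixes E :: "'a::metric_space set"
  assumes "T \<ge> 0"
    and ev0: "eventually (\<lambda>\<delta>. real (covering_number E \<delta>) \<le> K0 * \<delta> powr (-T)) (at_right 0)"
  shows "upper_box_dim E \<le> ereal T"
proof -
  \<comment> \<open>A constant of at least \<open>1\<close> keeps the logarithm of the bound nonnegative, which also covers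
    the default value \<open>ln 0 = 0\<close> when the covering number is \<open>0\<close>.\<close>
  define K where "K = max K0 1"
  have K: "K \<ge> 1" "K > 0" by (auto simp: K_def)
  have ev: "eventually (\<lambda>\<delta>. real (covering_number E \<delta>) \<le> K * \<delta> powr (-T)) (at_right 0)"
    using ev0 by eventually_elim (auto simp: K_def elim!: order_trans intro!: mult_right_mono)
  have bound: "ln (real (covering_number E \<delta>)) / - ln \<delta> \<le> ln K / - ln \<delta> + T"
    if "0 < \<delta>" "\<delta> < 1" "K * \<delta> powr (-T) \<ge> 1" "real (covering_number E \<delta>) \<le> K * \<delta> powr (-T)" for \<delta>
  proof -
    have "ln (real (covering_number E \<delta>)) \<le> ln (K * \<delta> powr (-T))"
      using that by (cases "covering_number E \<delta> = 0") (auto simp: ln_ge_zero)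
    also have "\<dots> = ln K + T * (- ln \<delta>)"
      using that \<open>K > 0\<close> by (simp add: ln_mult ln_powr)
    finally show ?thesis
      using that by (simp add: divide_simps)
  qed
  have large: "K * \<delta> powr (-T) \<ge> 1" if "0 < \<delta>" "\<delta> < 1" for \<delta>
  proof -
    have "\<delta> powr (-T) \<ge> 1"
      using that \<open>T \<ge> 0\<close> by (simp add: powr_minus divide_simps powr_le1)
    then show ?thesis using mult_mono[of 1 K 1 "\<delta> powr (-T)"] K by simp
  qed
  have "eventually (\<lambda>\<delta>::real. 0 < \<delta> \<and> \<delta> < 1) (at_right 0)"
    unfolding eventually_at_right_0 by (intro exI[of _ 1]) auto
  with ev have "eventually (\<lambda>\<delta>. ln (real (covering_number E \<delta>)) / - ln \<delta> \<le> ln K / - ln \<delta> + T) (at_right 0)"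
    by eventually_elim (use bound large in blast)
  then have "upper_box_dim E \<le> Limsup (at_right 0) (\<lambda>\<delta>. ereal (ln K / - ln \<delta> + T))"
    unfolding upper_box_dim_def by (intro Limsup_mono) (auto elim!: eventually_mono)
  also have "((\<lambda>\<delta>::real. ln K / - ln \<delta> + T) \<longlongrightarrow> 0 + T) (at_right 0)"
    by (intro tendsto_intros tendsto_divide_0[OF tendsto_const] filterlim_at_top_imp_at_infinity)
       (use ln_at_0 in \<open>simp add: filterlim_uminus_at_top\<close>)
  then have "Limsup (at_right 0) (\<lambda>\<delta>. ereal (ln K / - ln \<delta> + T)) = ereal (0 + T)"
    by (intro lim_imp_Limsup) auto
  finally show ?thesis by simp
qed

lemma upper_box_dim_lessD:
  fixes E :: "'a::metric_space set"
  assumes "upper_box_dim E < ereal t"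
  shows "t > 0" "\<exists>b>0. b \<le> 1 \<and> (\<forall>\<delta>. 0 < \<delta> \<and> \<delta> < b \<longrightarrow> real (covering_number E \<delta>) \<le> \<delta> powr (-t))"
proof -
  have "eventually (\<lambda>\<delta>. ereal (ln (real (covering_number E \<delta>)) / - ln \<delta>) < ereal t) (at_right 0)"
    using assms unfolding upper_box_dim_def by (rule Limsup_lessD)
  then obtain b where b: "b > 0" "\<And>\<delta>. 0 < \<delta> \<Longrightarrow> \<delta> < b \<Longrightarrow> ln (real (covering_number E \<delta>)) / - ln \<delta> < t"
    unfolding eventually_at_right_0 by auto
  have cover: "t > 0 \<and> real (covering_number E \<delta>) \<le> \<delta> powr (-t)" if "0 < \<delta>" "\<delta> < min b 1" for \<delta>
  proof -
    have ln: "ln \<delta> < 0" using that by simp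
    have nonneg: "0 \<le> ln (real (covering_number E \<delta>))"
      by (cases "covering_number E \<delta> = 0") (auto simp: ln_ge_zero)
    have quot: "ln (real (covering_number E \<delta>)) / - ln \<delta> < t" using b that by simp
    then have "ln (real (covering_number E \<delta>)) < t * - ln \<delta>"
      using ln by (subst (asm) pos_divide_less_eq) auto
    from exp_less_mono[OF this] have "real (covering_number E \<delta>) \<le> exp (t * - ln \<delta>)"
      by (cases "covering_number E \<delta> = 0") auto
    moreover have "0 \<le> ln (real (covering_number E \<delta>)) / - ln \<delta>"
      using nonneg ln by (intro divide_nonneg_pos) auto
    ultimately show ?thesis using quot that by (auto simp: powr_def)
  qed
  have *: "0 < min b 1" using b(1) by simp
  show "t > 0" using cover[of "min b 1 / 2"] * by linarith
  show "\<exists>b>0. b \<le> 1 \<and> (\<forall>\<delta>. 0 < \<delta> \<and> \<delta> < b \<longrightarrow> real (covering_number E \<delta>) \<le> \<delta> powr (-t))"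
    using cover * by (intro exI[of _ "min b 1"]) auto
qed

definition dyadic_class :: "('v \<Rightarrow> real) \<Rightarrow> 'v set \<Rightarrow> nat \<Rightarrow> 'v set" where
  "dyadic_class w S n = {v \<in> S. (1/2) ^ Suc n < w v \<and> w v \<le> (1/2) ^ n}"

lemma dyadic_index:
  fixes x :: real
  assumes "0 < x" "x \<le> 1"
  obtains n where "(1/2) ^ Suc n < x" "x \<le> (1/2) ^ n"
proof -
  obtain m where m: "(1/2::real) ^ m < x"
    using real_arch_pow_inv[OF assms(1), of "1/2"] by auto
  define k where "k = (LEAST m. (1/2::real) ^ m < x)"
  have k: "(1/2::real) ^ k < x" unfolding k_def using m by (rule LeastI)
  then have "k \<noteq> 0" using assms(2) by (metis not_less power_0)
  then obtain n where n: "k = Suc n" using not0_implies_Suc by blast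
  then have "\<not> (1/2::real) ^ n < x" using not_less_Least[of n "\<lambda>m. (1/2::real) ^ m < x"] k_def by auto
  with k n show thesis using that by (auto simp: not_less)
qed

text \<open>
  A dyadic class whose size is governed by the exponent \<open>s\<close> contributes a term of a geometric series
  to a sum with a larger exponent \<open>t\<close>. Packing sums are bounded this way; read contrapositively,
  a large sum over words forces a single class to be large.
\<close>

lemma dyadic_sum_bound:
  assumes fin: "finite S" and w: "\<And>v. v \<in> S \<Longrightarrow> 0 < w v \<and> w v \<le> 1"
    and "0 \<le> t" "s < t"
    and count: "\<And>n. real (card (dyadic_class w S n)) \<le> K * ((1/2) ^ n) powr (-s)"
  shows "(\<Sum>v\<in>S. w v powr t) \<le> K / (1 - (1/2) powr (t - s))"
proof -
  have "\<forall>v\<in>S. \<exists>n. (1/2) ^ Suc n < w v \<and> w v \<le> (1/2) ^ n"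
    using w dyadic_index by metis
  then obtain idx where idx: "\<And>v. v \<in> S \<Longrightarrow> v \<in> dyadic_class w S (idx v)"
    unfolding dyadic_class_def by (metis (no_types, lifting) mem_Collect_eq)
  define q :: real where "q = (1/2) powr (t - s)"
  have q: "0 < q" "q < 1" using \<open>s < t\<close> by (auto simp: q_def powr01_less_one)
  have K: "K \<ge> 0" using count[of 0] order_trans[OF of_nat_0_le_iff] by fastforce
  have "(\<Sum>v\<in>S. w v powr t) = (\<Sum>n\<in>idx ` S. \<Sum>v\<in>{v\<in>S. idx v = n}. w v powr t)"
    using fin by (rule sum.image_gen)
  also have "\<dots> \<le> (\<Sum>n\<in>idx ` S. K * q ^ n)"
  proof (rule sum_mono)
    fix n
    have "(\<Sum>v\<in>{v\<in>S. idx v = n}. w v powr t) \<le> (\<Sum>v\<in>dyadic_class w S n. ((1/2) ^ n) powr t)"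
      using fin idx w \<open>0 \<le> t\<close>
      by (intro sum_le_included[where i = id])
         (auto simp: dyadic_class_def less_imp_le intro!: powr_mono2 bexI)
    also have "\<dots> \<le> K * ((1/2) ^ n) powr (-s) * ((1/2) ^ n) powr t"
      using count[of n] by (simp add: mult_right_mono)
    also have "\<dots> = K * ((1/2) ^ n) powr (t - s)"
      by (simp add: mult.assoc flip: powr_add)
    also have "((1/2::real) ^ n) powr (t - s) = q ^ n"
      by (simp add: q_def powr_powr mult.commute flip: powr_realpow)
    finally show "(\<Sum>v\<in>{v\<in>S. idx v = n}. w v powr t) \<le> K * q ^ n" .
  qed
  also have "\<dots> \<le> (\<Sum>n. K * q ^ n)"
    using fin q K by (intro sum_le_suminf summable_mult summable_geometric) auto
  also have "\<dots> = K / (1 - q)"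
    using q by (simp add: suminf_mult summable_geometric suminf_geometric)
  finally show ?thesis by (simp add: q_def)
qed

section \<open>Packing dimension\<close>

lemma packing_sum_le_dyadic:
  fixes E :: "'a::euclidean_space set"
  assumes "bounded E" and b: "b \<le> 1"
    and cover: "\<And>\<delta>. 0 < \<delta> \<Longrightarrow> \<delta> < b \<Longrightarrow> real (covering_number E \<delta>) \<le> \<delta> powr (-t)"
    and B: "finite B" "\<And>x r. (x, r) \<in> B \<Longrightarrow> x \<in> E \<and> 0 < r \<and> r < b"
    and disj: "disjoint_family_on (\<lambda>(x, r). cball x r) B"
    and "0 \<le> t" "t < u"
  shows "(\<Sum>(x, r)\<in>B. r powr u) \<le> 2 powr t / (1 - (1/2) powr (u - t))"
proof -
  have count: "real (card (dyadic_class snd B n)) \<le> 2 powr t * ((1/2) ^ n) powr (-t)" for n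
  proof (cases "dyadic_class snd B n = {}")
    case False
    define \<delta> :: real where "\<delta> = (1/2) ^ Suc n"
    have "\<delta> < b" "\<delta> > 0"
      using False B(2) by (fastforce simp: dyadic_class_def \<delta>_def)+
    obtain \<U> where \<U>: "finite \<U>" "card \<U> = covering_number E \<delta>"
      "\<And>A. A \<in> \<U> \<Longrightarrow> bounded A \<and> diameter A \<le> \<delta>" "E \<subseteq> \<Union>\<U>"
      using covering_number_attained[OF \<open>bounded E\<close> \<open>\<delta> > 0\<close>] by blast
    have "\<forall>p\<in>dyadic_class snd B n. \<exists>A\<in>\<U>. fst p \<in> A"
      using B(2) \<U>(4) by (fastforce simp: dyadic_class_def)
    then obtain f where f: "\<And>p. p \<in> dyadic_class snd B n \<Longrightarrow> f p \<in> \<U> \<and> fst p \<in> f p"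
      by metis
    \<comment> \<open>Two centres in one set of the cover are closer than either radius.\<close>
    have "inj_on f (dyadic_class snd B n)"
    proof (rule inj_onI, rule ccontr)
      fix p q assume pq: "p \<in> dyadic_class snd B n" "q \<in> dyadic_class snd B n" "f p = f q" "p \<noteq> q"
      have "bounded (f p)" "diameter (f p) \<le> \<delta>" using f[OF pq(1)] \<U>(3) by auto
      then have "dist (fst p) (fst q) \<le> \<delta>"
        using f pq diameter_bounded_bound[of "f p" "fst p" "fst q"] by fastforce
      then have "fst q \<in> cball (fst p) (snd p)" "fst q \<in> cball (fst q) (snd q)"
        using pq B(2)[of "fst q" "snd q"] by (auto simp: dyadic_class_def \<delta>_def less_imp_le)
      moreover have "cball (fst p) (snd p) \<inter> cball (fst q) (snd q) = {}"
        using disj pq unfolding disjoint_family_on_def dyadic_class_def case_prod_unfold by blast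
      ultimately show False by blast
    qed
    then have "card (dyadic_class snd B n) \<le> covering_number E \<delta>"
      using f \<U>(1,2) by (metis card_inj_on_le image_subsetI)
    then have "real (card (dyadic_class snd B n)) \<le> \<delta> powr (-t)"
      using cover[OF \<open>\<delta> > 0\<close> \<open>\<delta> < b\<close>] by linarith
    also have "\<delta> powr (-t) = 2 powr t * ((1/2) ^ n) powr (-t)"
      by (simp add: \<delta>_def powr_divide powr_mult powr_minus divide_simps)
    finally show ?thesis .
  qed simp
  show ?thesis
    unfolding case_prod_unfold
    using B b \<open>0 \<le> t\<close> \<open>t < u\<close>
    by (intro dyadic_sum_bound[where w = snd and s = t] count) fastforce+
qed

text \<open>
  A packing of \<open>E\<close> by balls of comparable radius \<open>r\<close> has at most as many members as a cover by sets of
  diameter below \<open>r\<close>. Summing over the dyadic classes of radii bounds all packing sums for every exponent above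
  the upper box dimension; a further increase of the exponent makes the premeasure vanish.
\<close>

theorem packing_dim_le_upper_box_dim:
  fixes E :: "'a::euclidean_space set"
  assumes "bounded E"
  shows "packing_dim E \<le> upper_box_dim E"
proof (rule ccontr)
  assume "\<not> packing_dim E \<le> upper_box_dim E"
  then obtain t where t: "upper_box_dim E < ereal t" and t': "ereal t < packing_dim E"
    using ereal_dense2 by (meson not_le)
  obtain v where v: "t < v" "ereal v < packing_dim E"
    using ereal_dense2[OF t'] by auto
  define u where "u = (t + v) / 2"
  have u: "t < u" "u < v" using v by (auto simp: u_def)
  have "t > 0" using upper_box_dim_lessD(1)[OF t] .
  obtain b where b: "b > 0" "b \<le> 1"
    "\<And>\<delta>. 0 < \<delta> \<Longrightarrow> \<delta> < b \<Longrightarrow> real (covering_number E \<delta>) \<le> \<delta> powr (-t)"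
    using upper_box_dim_lessD(2)[OF t] by auto
  define K where "K = 2 powr v * (2 powr t / (1 - (1/2) powr (u - t)))"
  have delta: "packing_delta v \<delta> E \<le> ennreal (\<delta> powr (v - u) * K)" if \<delta>: "0 < \<delta>" "\<delta> < b" for \<delta>
    unfolding packing_delta_def
  proof (rule SUP_least)
    fix B assume B: "B \<in> packings \<delta> E"
    have Br: "x \<in> E \<and> 0 < r \<and> r \<le> \<delta>" if "(x, r) \<in> B" for x r
      using B that unfolding packings_def by auto
    have disj: "disjoint_family_on (\<lambda>(x, r). cball x r) B" using B unfolding packings_def by auto
    have "(\<Sum>\<^sub>\<infinity>(x, r)\<in>B. ennreal (diameter (cball x r) powr v)) =
          (SUP F\<in>{F. finite F \<and> F \<subseteq> B}. \<Sum>(x, r)\<in>F. ennreal (diameter (cball x r) powr v))"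
      by (intro nonneg_infsum_complete) auto
    also have "\<dots> \<le> ennreal (\<delta> powr (v - u) * K)"
    proof (rule SUP_least, clarify)
      fix F assume F: "finite F" "F \<subseteq> B"
      have "(\<Sum>(x, r)\<in>F. ennreal (diameter (cball x r) powr v))
          = ennreal (\<Sum>p\<in>F. diameter (cball (fst p) (snd p)) powr v)"
        unfolding case_prod_unfold by (rule sum_ennreal) auto
      also have "\<dots> \<le> ennreal (\<Sum>p\<in>F. \<delta> powr (v - u) * 2 powr v * snd p powr u)"
      proof (intro ennreal_leI sum_mono)
        fix p assume "p \<in> F"
        then have r: "0 < snd p" "snd p \<le> \<delta>" using F Br[of "fst p" "snd p"] by auto
        have "diameter (cball (fst p) (snd p)) powr v = 2 powr v * (snd p powr (v - u) * snd p powr u)"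
          using r by (simp add: powr_mult flip: powr_add)
        also have "\<dots> \<le> 2 powr v * (\<delta> powr (v - u) * snd p powr u)"
          using r u by (intro mult_left_mono mult_right_mono powr_mono2) auto
        finally show "diameter (cball (fst p) (snd p)) powr v \<le> \<delta> powr (v - u) * 2 powr v * snd p powr u"
          by (simp add: mult_ac)
      qed
      also have "(\<Sum>p\<in>F. \<delta> powr (v - u) * 2 powr v * snd p powr u)
          = \<delta> powr (v - u) * 2 powr v * (\<Sum>(x, r)\<in>F. r powr u)"
        by (simp add: sum_distrib_left case_prod_unfold)
      also have "(\<Sum>(x, r)\<in>F. r powr u) \<le> 2 powr t / (1 - (1/2) powr (u - t))"
      proof (rule packing_sum_le_dyadic[OF assms b(2,3) F(1)])
        show "x \<in> E \<and> 0 < r \<and> r < b" if "(x, r) \<in> F" for x r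
          using Br[of x r] F(2) that \<delta> by auto
        show "disjoint_family_on (\<lambda>(x, r). cball x r) F"
          using disj F(2) by (rule disjoint_family_on_mono[rotated])
      qed (use \<open>t > 0\<close> u in auto)
      finally have "(\<Sum>(x, r)\<in>F. ennreal (diameter (cball x r) powr v)) \<le>
          ennreal (\<delta> powr (v - u) * 2 powr v * (2 powr t / (1 - (1/2) powr (u - t))))"
        by (simp add: mult_left_mono ennreal_leI)
      then show "(\<Sum>(x, r)\<in>F. ennreal (diameter (cball x r) powr v)) \<le> ennreal (\<delta> powr (v - u) * K)"
        by (simp add: K_def mult.assoc)
    qed
    finally show "(\<Sum>\<^sub>\<infinity>(x, r)\<in>B. ennreal (diameter (cball x r) powr v)) \<le> ennreal (\<delta> powr (v - u) * K)" .
  qed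
  have "((\<lambda>\<delta>. \<delta> powr (v - u) * K) \<longlongrightarrow> 0 powr (v - u) * K) (at_right 0)"
    using u by (intro tendsto_intros tendsto_powr') (auto simp: eventually_at_right_0 intro: exI[of _ 1])
  then have "((\<lambda>\<delta>. ennreal (\<delta> powr (v - u) * K)) \<longlongrightarrow> ennreal 0) (at_right 0)"
    by (intro tendsto_ennrealI) simp
  moreover have "eventually (\<lambda>\<delta>. packing_premeasure v E \<le> ennreal (\<delta> powr (v - u) * K)) (at_right 0)"
    unfolding eventually_at_right_0 packing_premeasure_def
    using b(1) delta by (intro exI[of _ b]) (auto intro: INF_lower2)
  ultimately have E0: "packing_premeasure v E = 0"
    using tendsto_lowerbound by fastforce
  have "packings \<delta> ({} :: 'a set) = {{}}" for \<delta> :: real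
    unfolding packings_def by (auto simp: disjoint_family_on_def) 
  then have empty: "packing_premeasure v ({} :: 'a set) = 0"
    unfolding packing_premeasure_def packing_delta_def by simp
  have "packing_measure v E \<le> (\<Sum>i. packing_premeasure v (if i = 0 then E else {}))"
    unfolding packing_measure_def by (intro INF_lower) (auto intro: exI[of _ 0])
  also have "\<dots> = (\<Sum>i. 0)"
    by (intro suminf_cong) (simp add: E0 empty)
  finally have "packing_measure v E = 0" by simp
  then have "packing_dim E \<le> ereal v"
    unfolding packing_dim_def using \<open>t > 0\<close> v by (intro Inf_lower) auto
  with v(2) show False by simp
qed

text \<open>
  If \<open>E\<close> has many well separated points near each of its points, then no countable family of sets of
  small packing premeasure covers \<open>E\<close>: by Baire's theorem the closure of some member contains a relatively open
  piece of \<open>E\<close>, and separated points of that piece can be moved into the member itself. The gap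
  between the separation \<open>3\<rho>\<close> and the ball diameter \<open>2\<rho>\<close> leaves room for this move.
\<close>

lemma packing_measure_nonzeroI:
  fixes E :: "'a::euclidean_space set"
  assumes "closed E" "E \<noteq> {}" "s \<ge> 0"
    and sep: "\<And>x e \<delta>. x \<in> E \<Longrightarrow> e > 0 \<Longrightarrow> \<delta> > 0 \<Longrightarrow>
      \<exists>X \<rho>. finite X \<and> X \<subseteq> E \<inter> ball x e \<and> 0 < \<rho> \<and> \<rho> \<le> \<delta> \<and>
        (\<forall>a\<in>X. \<forall>b\<in>X. a \<noteq> b \<longrightarrow> 3 * \<rho> \<le> dist a b) \<and> 1 \<le> real (card X) * \<rho> powr s"
  shows "packing_measure s E \<noteq> 0"
proof
  assume "packing_measure s E = 0"
  then have "packing_measure s E < 1" by simp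
  then obtain F :: "nat \<Rightarrow> 'a set" where F: "E \<subseteq> (\<Union>i. F i)" "(\<Sum>i. packing_premeasure s (F i)) < 1"
    unfolding packing_measure_def INF_less_iff by auto
  have pre: "packing_premeasure s (F i) < 1" for i
  proof -
    have "(\<Sum>j\<in>{i}. packing_premeasure s (F j)) \<le> (\<Sum>j. packing_premeasure s (F j))"
      by (intro sum_le_suminf) auto
    with F(2) show ?thesis by simp
  qed
  have "\<exists>i. \<not> E \<subseteq> closure (E - closure (F i))"
  proof (rule ccontr)
    assume "\<not> ?thesis"
    then have "E \<subseteq> closure (\<Inter>(range (\<lambda>i. E - closure (F i))))"
      by (intro Baire[OF \<open>closed E\<close>])
         (auto simp: Diff_eq intro!: openin_open_Int)
    moreover have "\<Inter>(range (\<lambda>i. E - closure (F i))) = {}"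
    proof -
      have "\<exists>i. x \<in> closure (F i)" if "x \<in> E" for x
        using F(1) that closure_subset by blast
      then show ?thesis by auto
    qed
    ultimately show False using \<open>E \<noteq> {}\<close> by (simp only: closure_empty subset_empty)
  qed
  then obtain i x where x: "x \<in> E" "x \<notin> closure (E - closure (F i))" by blast
  then obtain e where e: "e > 0" "ball x e \<inter> (E - closure (F i)) = {}"
    unfolding closure_approachable by (auto simp: dist_commute disjoint_iff)
  obtain \<delta> where \<delta>: "\<delta> > 0" "packing_delta s \<delta> (F i) < 1"
    using pre[of i] unfolding packing_premeasure_def INF_less_iff by auto
  obtain X \<rho> where X: "finite X" "X \<subseteq> E \<inter> ball x e" "0 < \<rho>" "\<rho> \<le> \<delta>"
    "\<And>a b. a \<in> X \<Longrightarrow> b \<in> X \<Longrightarrow> a \<noteq> b \<Longrightarrow> 3 * \<rho> \<le> dist a b" "1 \<le> real (card X) * \<rho> powr s"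
    using sep[OF x(1) e(1) \<delta>(1)] by blast
  have "X \<subseteq> closure (F i)" using X(2) e(2) by blast
  then have "\<forall>a\<in>X. \<exists>y\<in>F i. dist y a < \<rho> / 2"
    using X(3) unfolding closure_approachable subset_iff by (meson half_gt_zero)
  then obtain y where y: "\<And>a. a \<in> X \<Longrightarrow> y a \<in> F i \<and> dist (y a) a < \<rho> / 2"
    by metis
  have far: "dist (y a) (y b) > 2 * \<rho>" if "a \<in> X" "b \<in> X" "a \<noteq> b" for a b
  proof -
    have "dist a b \<le> dist (y a) a + dist (y a) (y b) + dist (y b) b"
      using dist_triangle[of a b "y a"] dist_triangle[of "y a" b "y b"] by (simp add: dist_commute)
    then show ?thesis using X(5)[OF that] y[OF that(1)] y[OF that(2)] by linarith
  qed
  let ?B = "(\<lambda>a. (y a, \<rho>)) ` X"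
  have inj: "inj_on (\<lambda>a. (y a, \<rho>)) X"
    using far X(3) by (fastforce simp: inj_on_def)
  have "disjoint_family_on (\<lambda>(x, r). cball x r) ?B"
  proof -
    have "cball (y a) \<rho> \<inter> cball (y b) \<rho> = {}" if "a \<in> X" "b \<in> X" "y a \<noteq> y b" for a b
    proof (rule ccontr)
      assume "\<not> ?thesis"
      then obtain z where "dist (y a) z \<le> \<rho>" "dist (y b) z \<le> \<rho>" by auto
      then have "dist (y a) (y b) \<le> 2 * \<rho>" using dist_triangle2[of "y a" "y b" z] by linarith
      then show False using far that by fastforce
    qed
    then show ?thesis by (auto simp: disjoint_family_on_def)
  qed
  then have B: "?B \<in> packings \<delta> (F i)"
    using X y by (auto simp: packings_def countable_finite)
  have "ennreal 1 \<le> ennreal (real (card X) * (2 * \<rho>) powr s)"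
  proof (rule ennreal_leI)
    have "\<rho> powr s \<le> (2 * \<rho>) powr s" using X(3) \<open>s \<ge> 0\<close> by (intro powr_mono2) auto
    then show "1 \<le> real (card X) * (2 * \<rho>) powr s"
      using X(6) by (meson mult_left_mono of_nat_0_le_iff order_trans)
  qed
  also have "\<dots> = (\<Sum>a\<in>X. ennreal (diameter (cball (y a) \<rho>) powr s))"
    using X(3) by (simp add: ennreal_mult' ennreal_of_nat_eq_real_of_nat)
  also have "\<dots> = (\<Sum>\<^sub>\<infinity>(x, r)\<in>?B. ennreal (diameter (cball x r) powr s))"
    using X(1) inj by (simp add: sum.reindex)
  also have "\<dots> \<le> packing_delta s \<delta> (F i)"
    unfolding packing_delta_def using B by (rule SUP_upper)
  finally show False using \<delta>(2) by simp
qed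

lemma packing_dim_geI:
  assumes "\<And>s. 0 \<le> s \<Longrightarrow> ereal s < d \<Longrightarrow> packing_measure s E \<noteq> 0"
  shows "d \<le> packing_dim E"
  unfolding packing_dim_def using assms by (intro Inf_greatest) (auto simp: not_less intro: leI)

section \<open>Conformal maps\<close>

definition conformal_at :: "('a::euclidean_space \<Rightarrow> 'a) \<Rightarrow> 'a \<Rightarrow> bool" where
  "conformal_at f x \<longleftrightarrow> (\<exists>A. (f has_derivative A) (at x) \<and> similarity_linear A)"

lemma conformal_at_derivative:
  assumes "conformal_at f x"
  obtains A where "(f has_derivative A) (at x)" "linear A"
    "\<And>v. norm (A v) = deriv_norm f x * norm v" "onorm A = deriv_norm f x" "deriv_norm f x > 0"
proof -
  obtain A r where A: "(f has_derivative A) (at x)" "linear A" "r > 0" "\<And>v. norm (A v) = r * norm v"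
    using assms unfolding conformal_at_def similarity_linear_def by blast
  have "deriv_norm f x = onorm A" unfolding deriv_norm_def using A(1) by (metis frechet_derivative_at)
  also have "onorm A = r" using A(4) by (rule onorm_eq_scaling_factor)
  finally show thesis using that A \<open>onorm A = r\<close> by simp
qed

lemma deriv_norm_pos: "conformal_at f x \<Longrightarrow> deriv_norm f x > 0"
  using conformal_at_derivative by blast

lemma conformal_at_compose:
  assumes g: "conformal_at g x" and f: "conformal_at f (g x)"
  shows "conformal_at (f \<circ> g) x" "deriv_norm (f \<circ> g) x = deriv_norm f (g x) * deriv_norm g x"
proof -
  obtain B where B: "(g has_derivative B) (at x)" "linear B"
    "\<And>v. norm (B v) = deriv_norm g x * norm v" "deriv_norm g x > 0"
    using conformal_at_derivative[OF g] by metis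
  obtain A where A: "(f has_derivative A) (at (g x))" "linear A"
    "\<And>v. norm (A v) = deriv_norm f (g x) * norm v" "deriv_norm f (g x) > 0"
    using conformal_at_derivative[OF f] by metis
  have AB: "((f \<circ> g) has_derivative (A \<circ> B)) (at x)"
    using diff_chain_at[OF B(1) A(1)] .
  have norm: "norm ((A \<circ> B) v) = deriv_norm f (g x) * deriv_norm g x * norm v" for v
    by (simp add: A(3) B(3))
  have "deriv_norm f (g x) * deriv_norm g x > 0" using A(4) B(4) by simp
  then show "conformal_at (f \<circ> g) x"
    unfolding conformal_at_def similarity_linear_def using AB norm A(2) B(2) linear_compose by blast
  show "deriv_norm (f \<circ> g) x = deriv_norm f (g x) * deriv_norm g x"
    unfolding deriv_norm_def[of "f \<circ> g"]
    using AB norm by (metis frechet_derivative_at onorm_eq_scaling_factor)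
qed

lemma conformal_at_id: "conformal_at id x" "deriv_norm id x = 1"
proof -
  have id: "(id has_derivative id) (at x)" by (simp add: id_def)
  have "similarity_linear (id :: 'a \<Rightarrow> 'a)"
    unfolding similarity_linear_def by (auto simp: linear_id intro!: exI[of _ 1])
  then show "conformal_at id x" unfolding conformal_at_def using id by blast
  show "deriv_norm id x = 1"
    unfolding deriv_norm_def using id
    by (metis frechet_derivative_at onorm_eq_scaling_factor id_apply mult_1)
qed

lemma conformal_diffeo_imp_conformal_at:
  assumes "conformal_diffeo_into V f" "x \<in> V"
  shows "conformal_at f x"
proof -
  obtain f' where "(f has_derivative f') (at x)"
    using assms unfolding conformal_diffeo_into_def C1_on_def by blast
  moreover from this have "frechet_derivative f (at x) = f'" by (metis frechet_derivative_at)
  ultimately show ?thesis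
    using assms unfolding conformal_at_def conformal_diffeo_into_def by metis
qed

lemma continuous_on_deriv_norm:
  assumes "C1_on V f"
  shows "continuous_on V (deriv_norm f)"
proof -
  obtain f' :: "'a \<Rightarrow> 'a \<Rightarrow>\<^sub>L 'a" where f': "continuous_on V f'"
    "\<And>x. x \<in> V \<Longrightarrow> (f has_derivative blinfun_apply (f' x)) (at x)"
    using assms unfolding C1_on_def by blast
  have "deriv_norm f x = norm (f' x)" if "x \<in> V" for x
    unfolding deriv_norm_def norm_blinfun.rep_eq using f'(2)[OF that] by (metis frechet_derivative_at)
  then show ?thesis using f'(1) by (simp add: continuous_on_norm cong: continuous_on_cong)
qed

lemma deriv_norm_le_lipschitz:
  fixes f :: "'a::euclidean_space \<Rightarrow> 'a"
  assumes "conformal_at f x" "open S" "x \<in> S"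
    and lip: "\<And>y. y \<in> S \<Longrightarrow> norm (f y - f x) \<le> c * norm (y - x)"
  shows "deriv_norm f x \<le> c"
proof (rule field_le_epsilon)
  fix e :: real assume "e > 0"
  obtain A where A: "(f has_derivative A) (at x)" "\<And>v. norm (A v) = deriv_norm f x * norm v"
    using conformal_at_derivative[OF assms(1)] by metis
  obtain d where d: "d > 0" "\<And>y. norm (y - x) < d \<Longrightarrow> norm (f y - f x - A (y - x)) \<le> e * norm (y - x)"
    using A(1) \<open>e > 0\<close> unfolding has_derivative_at_alt by blast
  obtain d' where d': "d' > 0" "ball x d' \<subseteq> S" using assms(2,3) openE by blast
  define h where "h = min d d' / 2"
  have h: "0 < h" "h < d" "h < d'" using d(1) d'(1) by (auto simp: h_def)
  obtain b :: 'a where b: "b \<in> Basis" using nonempty_Basis by blast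
  define y where "y = x + h *\<^sub>R b"
  have y: "norm (y - x) = h" using b h by (simp add: y_def)
  have "y \<in> S" using d'(2) h y by (auto simp: dist_norm norm_minus_commute subset_iff)
  have "deriv_norm f x * h = norm (A (y - x))" by (simp add: A(2) y)
  also have "\<dots> \<le> norm (f y - f x) + norm (f y - f x - A (y - x))"
    by (metis norm_triangle_sub norm_minus_commute add.commute)
  also have "\<dots> \<le> c * h + e * h"
    using lip[OF \<open>y \<in> S\<close>] d(2)[of y] y h by (intro add_mono) auto
  finally show "deriv_norm f x \<le> c + e" using h(1) by (simp flip: distrib_right)
qed

text \<open>
  The set \<open>V\<close> need not be convex, so two points of \<open>J\<close> are joined through balls inside \<open>V\<close>; the
  number of balls depends on the points but not on the map. Compactness of \<open>J\<close> then bounds it.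
\<close>

lemma uniform_oscillation:
  fixes V J :: "'a::euclidean_space set"
  assumes V: "open V" "connected V" and J: "compact J" "J \<subseteq> V"
  obtains L where "L > 0"
    "\<And>f r x y. \<lbrakk>\<And>z. z \<in> V \<Longrightarrow> conformal_at f z \<and> deriv_norm f z \<le> r; x \<in> J; y \<in> J\<rbrakk>
       \<Longrightarrow> dist (f x) (f y) \<le> L * r"
proof -
  define \<F> :: "(('a \<Rightarrow> 'a) \<times> real) set"
    where "\<F> = {(f, r). \<forall>z\<in>V. conformal_at f z \<and> deriv_norm f z \<le> r}"
  define R where "R = (\<lambda>x y. \<exists>L. \<forall>(f, r)\<in>\<F>. dist (f x) (f y) \<le> L * r)"
  have lip: "dist (f x) (f y) \<le> e * r" if "ball x e \<subseteq> V" "y \<in> ball x e" "(f, r) \<in> \<F>" for x y e f r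
  proof -
    have f: "conformal_at f z" "deriv_norm f z \<le> r" if "z \<in> ball x e" for z
      using \<open>(f, r) \<in> \<F>\<close> \<open>ball x e \<subseteq> V\<close> that by (auto simp: \<F>_def)
    have "\<forall>z\<in>ball x e. \<exists>A. (f has_derivative A) (at z) \<and> onorm A = deriv_norm f z"
      using f(1) conformal_at_derivative by metis
    then obtain f' where f': "\<And>z. z \<in> ball x e \<Longrightarrow> (f has_derivative f' z) (at z) \<and> onorm (f' z) = deriv_norm f z"
      by metis
    have x: "x \<in> ball x e" using that(2) by (auto intro: le_less_trans[OF zero_le_dist])
    have "norm (f x - f y) \<le> r * norm (x - y)"
      by (rule differentiable_bound[of "ball x e" f f'])
         (use f' f(2) x that(2) in \<open>auto intro: has_derivative_at_withinI\<close>)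
    also have "\<dots> \<le> r * e"
      using that(2) deriv_norm_pos[OF f(1)[OF x]] f(2)[OF x]
      by (intro mult_left_mono) (auto simp: dist_norm less_imp_le)
    finally show ?thesis by (simp add: dist_norm mult.commute)
  qed
  have R: "R x y" if "x \<in> V" "y \<in> V" for x y
  proof (rule connected_equivalence_relation[OF V(2) that, of R])
    fix x y z
    show "R y x" if "R x y" using that by (simp add: R_def dist_commute)
    show "R x z" if xy: "R x y" and yz: "R y z"
    proof -
      obtain L L' where "\<forall>(f, r)\<in>\<F>. dist (f x) (f y) \<le> L * r" "\<forall>(f, r)\<in>\<F>. dist (f y) (f z) \<le> L' * r"
        using xy yz unfolding R_def by blast
      then have "\<forall>(f, r)\<in>\<F>. dist (f x) (f z) \<le> (L + L') * r"
        by (fastforce simp: distrib_right intro: order_trans[OF dist_triangle add_mono])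
      then show ?thesis unfolding R_def by blast
    qed
  next
    fix a assume "a \<in> V"
    then obtain e where e: "e > 0" "ball a e \<subseteq> V" using V(1) openE by blast
    have "\<forall>x\<in>ball a e. R a x" using lip[OF e(2)] unfolding R_def by blast
    then show "\<exists>T. openin (top_of_set V) T \<and> a \<in> T \<and> (\<forall>x\<in>T. R a x)"
      using e V(1) by (intro exI[of _ "ball a e"]) (auto intro: open_subset)
  qed
  show thesis
  proof (cases "J = {}")
    case True then show thesis using that[of 1] by simp
  next
    case False
    then obtain x0 where x0: "x0 \<in> J" by blast
    have "\<forall>x\<in>J. \<exists>e>0. ball x e \<subseteq> V" using V(1) J(2) openE by (meson subsetD)
    then obtain e where e: "\<And>x. x \<in> J \<Longrightarrow> e x > 0 \<and> ball x (e x) \<subseteq> V" by metis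
    have "\<forall>x\<in>J. \<exists>L. \<forall>(f, r)\<in>\<F>. dist (f x0) (f x) \<le> L * r"
      using R x0 J(2) unfolding R_def by (meson subsetD)
    then obtain K where K: "\<And>x f r. x \<in> J \<Longrightarrow> (f, r) \<in> \<F> \<Longrightarrow> dist (f x0) (f x) \<le> K x * r"
      by (metis (no_types, lifting) case_prodD)
    have "J \<subseteq> (\<Union>x\<in>J. ball x (e x))" using e by force
    then obtain C where C: "C \<subseteq> J" "finite C" "J \<subseteq> (\<Union>x\<in>C. ball x (e x))"
      using compactE_image[OF J(1), of J "\<lambda>x. ball x (e x)"] by (metis open_ball)
    define M where "M = (\<Sum>x\<in>C. \<bar>K x\<bar> + e x)"
    have base: "dist (f x0) (f y) \<le> M * r" if fr: "(f, r) \<in> \<F>" and y: "y \<in> J" for f r y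
    proof -
      obtain x where x: "x \<in> C" "y \<in> ball x (e x)" using C(3) y by blast
      have "r > 0" using fr x0 J(2) deriv_norm_pos unfolding \<F>_def by fastforce
      have "dist (f x0) (f y) \<le> K x * r + e x * r"
        using K[of x f r] lip[of x "e x" y f r] e[of x] x C(1) fr
        by (intro order_trans[OF dist_triangle add_mono]) auto
      also have "\<dots> \<le> (\<bar>K x\<bar> + e x) * r"
        using \<open>r > 0\<close> by (simp add: distrib_right)
      also have "\<bar>K x\<bar> + e x \<le> M"
      proof -
        have "0 \<le> \<bar>K z\<bar> + e z" if "z \<in> C" for z using e[of z] that C(1) by force
        then show ?thesis unfolding M_def using C(2) by (intro member_le_sum[OF x(1)]) auto
      qed
      finally show ?thesis using \<open>r > 0\<close> by (simp add: mult_right_mono)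
    qed
    show thesis
    proof (rule that[of "2 * \<bar>M\<bar> + 1"])
      fix f r x y
      assume f: "\<And>z. z \<in> V \<Longrightarrow> conformal_at f z \<and> deriv_norm f z \<le> r" and xy: "x \<in> J" "y \<in> J"
      then have fr: "(f, r) \<in> \<F>" by (simp add: \<F>_def)
      have r: "r > 0" using f x0 J(2) deriv_norm_pos by fastforce
      have "dist (f x) (f y) \<le> M * r + M * r"
        using base[OF fr xy(1)] base[OF fr xy(2)] dist_triangle3[of "f x" "f y" "f x0"] by linarith
      also have "\<dots> \<le> (2 * \<bar>M\<bar> + 1) * r"
        using r by (auto simp: distrib_right mult_right_mono intro: add_increasing2)
      finally show "dist (f x) (f y) \<le> (2 * \<bar>M\<bar> + 1) * r" .
    qed simp
  qed
qed

text \<open>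
  Let \<open>\<delta>\<close> be the distance from \<open>f a\<close> to the image of the sphere. The boundary of the image of the
  ball lies in the image of the sphere, so the ball of radius \<open>\<delta>\<close> around \<open>f a\<close> is covered; on its closure the inverse
  map is Lipschitz with constant \<open>1 / m\<close>, which moves a point at distance \<open>\<delta>\<close> from \<open>f a\<close> to one at distance
  \<open>\<rho>\<close> from \<open>a\<close> and forces \<open>\<delta> \<ge> m \<rho>\<close>.
\<close>

lemma conformal_image_contains_ball:
  fixes f :: "'a::euclidean_space \<Rightarrow> 'a"
  assumes S: "open S" "cball a \<rho> \<subseteq> S" and inj: "inj_on f S"
    and "m > 0" "\<rho> > 0"
    and conf: "\<And>x. x \<in> S \<Longrightarrow> conformal_at f x \<and> m \<le> deriv_norm f x"
  shows "ball (f a) (m * \<rho>) \<subseteq> f ` ball a \<rho>"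
proof -
  have "\<forall>x\<in>S. \<exists>A. (f has_derivative A) (at x) \<and> linear A \<and> (\<forall>v. norm (A v) = deriv_norm f x * norm v)"
    using conf conformal_at_derivative by metis
  then obtain A where A: "\<And>x. x \<in> S \<Longrightarrow> (f has_derivative A x) (at x)" "\<And>x. x \<in> S \<Longrightarrow> linear (A x)"
    "\<And>x v. x \<in> S \<Longrightarrow> norm (A x v) = deriv_norm f x * norm v"
    by metis
  have cont: "continuous_on S f"
    using A(1) by (meson continuous_at_imp_continuous_on has_derivative_continuous)
  have sub: "ball a \<rho> \<subseteq> S" "sphere a \<rho> \<subseteq> S" using S(2) by force+
  have "compact (sphere a \<rho>)" "sphere a \<rho> \<noteq> {}" using \<open>\<rho> > 0\<close> by auto
  moreover have "continuous_on (sphere a \<rho>) (\<lambda>x. dist (f a) (f x))"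
    using continuous_on_subset[OF cont sub(2)] by (intro continuous_intros)
  ultimately obtain x1 where x1: "x1 \<in> sphere a \<rho>" "\<And>x. x \<in> sphere a \<rho> \<Longrightarrow> dist (f a) (f x1) \<le> dist (f a) (f x)"
    using continuous_attains_inf[of "sphere a \<rho>" "\<lambda>x. dist (f a) (f x)"] by blast
  define \<delta> where "\<delta> = dist (f a) (f x1)"
  have x1S: "x1 \<in> S" "x1 \<noteq> a" using x1(1) sub \<open>\<rho> > 0\<close> by auto
  have aS: "a \<in> S" "a \<in> ball a \<rho>" using S(2) \<open>\<rho> > 0\<close> by auto
  have "\<delta> > 0" using inj x1S aS unfolding \<delta>_def by (metis inj_onD zero_less_dist_iff)
  have "compact (f ` cball a \<rho>)"
    using continuous_on_subset[OF cont S(2)] by (intro compact_continuous_image) auto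
  then have clim: "closed (f ` cball a \<rho>)" by (rule compact_imp_closed)
  have "open (f ` ball a \<rho>)"
    using cont inj sub(1) by (intro invariance_of_domain) (auto intro: continuous_on_subset inj_on_subset)
  have inside: "ball (f a) \<delta> \<subseteq> f ` ball a \<rho>"
  proof (rule ccontr)
    assume "\<not> ?thesis"
    then have "ball (f a) \<delta> - f ` ball a \<rho> \<noteq> {}" by blast
    moreover have "ball (f a) \<delta> \<inter> f ` ball a \<rho> \<noteq> {}" using \<open>\<delta> > 0\<close> aS(2) by (metis IntI centre_in_ball empty_iff imageI)
    ultimately have "ball (f a) \<delta> \<inter> frontier (f ` ball a \<rho>) \<noteq> {}"
      by (intro connected_Int_frontier) auto
    then obtain z where z: "z \<in> ball (f a) \<delta>" "z \<in> closure (f ` ball a \<rho>)" "z \<notin> f ` ball a \<rho>"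
      using \<open>open (f ` ball a \<rho>)\<close> by (auto simp: frontier_def interior_open)
    have "closure (f ` ball a \<rho>) \<subseteq> f ` cball a \<rho>"
      using clim by (intro closure_minimal image_mono) auto
    then obtain x where x: "x \<in> cball a \<rho>" "z = f x" using z(2) by blast
    with z(3) have "x \<in> sphere a \<rho>" by auto
    then show False using x1(2)[of x] z(1) x(2) by (auto simp: \<delta>_def)
  qed
  define g where "g = inv_into S f"
  have gf: "g (f x) = x" if "x \<in> S" for x using inj that by (simp add: g_def)
  have gder: "\<exists>B. (g has_derivative B) (at (f x)) \<and> onorm B \<le> 1 / m" if x: "x \<in> S" for x
  proof -
    have dn: "deriv_norm f x > 0" "m \<le> deriv_norm f x" using conf[OF x] deriv_norm_pos by auto
    have "inj (A x)"
      unfolding linear_injective_0[OF A(2)[OF x]] using A(3)[OF x] dn(1)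
      by (metis mult_eq_0_iff norm_eq_zero less_irrefl)
    then obtain B where B: "linear B" "\<And>v. A x (B v) = v"
      using linear_injective_isomorphism[OF A(2)[OF x]] by metis
    have "norm (B v) = norm v / deriv_norm f x" for v
      using A(3)[OF x, of "B v"] B(2)[of v] dn(1) by (simp add: field_simps)
    then have "norm (B v) \<le> 1 / m * norm v" for v
      using dn \<open>m > 0\<close> by (simp add: frac_le)
    moreover have "(g has_derivative B) (at (f x))"
      by (rule has_derivative_inverse_strong[OF S(1) x cont gf A(1)[OF x]]) (auto simp: B(2))
    ultimately show ?thesis using onorm_bound \<open>m > 0\<close> by (metis divide_nonneg_pos less_eq_real_def zero_le_one)
  qed
  have "cball (f a) \<delta> = closure (ball (f a) \<delta>)" using \<open>\<delta> > 0\<close> by simp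
  also have "\<dots> \<subseteq> f ` cball a \<rho>"
    using clim inside by (intro closure_minimal) (auto simp: subset_iff image_iff Ball_def, fastforce?)
  finally have cb: "cball (f a) \<delta> \<subseteq> f ` S" using S(2) by blast
  then have "\<forall>w\<in>cball (f a) \<delta>. \<exists>B. (g has_derivative B) (at w) \<and> onorm B \<le> 1 / m"
    using gder by blast
  then obtain g' where g': "\<And>w. w \<in> cball (f a) \<delta> \<Longrightarrow> (g has_derivative g' w) (at w) \<and> onorm (g' w) \<le> 1 / m"
    by metis
  have "norm (g (f x1) - g (f a)) \<le> 1 / m * norm (f x1 - f a)"
    by (rule differentiable_bound[of "cball (f a) \<delta>" g g'])
       (use g' \<open>\<delta> > 0\<close> in \<open>auto intro: has_derivative_at_withinI simp: \<delta>_def\<close>)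
  then have "\<rho> \<le> 1 / m * \<delta>"
    using x1(1) by (simp add: gf x1S aS \<delta>_def dist_norm norm_minus_commute)
  then have "m * \<rho> \<le> \<delta>" using \<open>m > 0\<close> by (simp add: field_simps)
  then show ?thesis using inside subset_ball by blast
qed

section \<open>Words\<close>

lemma words_Nil: "[] \<in> words I 1 0"
  by (simp add: words_def)

lemma length_words: "u \<in> words I 1 k \<Longrightarrow> length u = k"
  by (simp add: words_def)

lemma words_Cons: "i # u \<in> words I l k \<longleftrightarrow> l \<le> k \<and> i \<in> I l \<and> u \<in> words I (Suc l) k"
  by (auto simp: words_def All_less_Suc2)

lemma words_append:
  "u \<in> words I 1 k \<Longrightarrow> w \<in> words I (Suc k) m \<Longrightarrow> k \<le> m \<Longrightarrow> u @ w \<in> words I 1 m"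
proof -
  assume u: "u \<in> words I 1 k" and w: "w \<in> words I (Suc k) m" and "k \<le> m"
  have "(u @ w) ! j \<in> I (1 + j)" if "j < m" for j
  proof (cases "j < k")
    case False
    then have "j - k < length w" using w that by (simp add: words_def)
    then have "w ! (j - k) \<in> I (Suc k + (j - k))" using w unfolding words_def by blast
    moreover have "Suc k + (j - k) = 1 + j" using False by simp
    ultimately have "w ! (j - k) \<in> I (1 + j)" by (simp only:)
    then show ?thesis using u False by (simp add: words_def nth_append)
  qed (use u in \<open>simp add: words_def nth_append\<close>)
  then show ?thesis using u w \<open>k \<le> m\<close> by (simp add: words_def)
qed

lemma words_snoc: "u @ [i] \<in> words I 1 (Suc k) \<longleftrightarrow> u \<in> words I 1 k \<and> i \<in> I (Suc k)"
  by (auto simp: words_def nth_append less_Suc_eq)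

lemma words_take: "v \<in> words I 1 m \<Longrightarrow> k \<le> m \<Longrightarrow> take k v \<in> words I 1 k"
  by (auto simp: words_def)

lemma words_drop: "v \<in> words I 1 m \<Longrightarrow> k \<le> m \<Longrightarrow> drop k v \<in> words I (Suc k) m"
  by (auto simp: words_def)

lemma finite_words:
  assumes "\<And>j. l \<le> j \<Longrightarrow> finite (I j)"
  shows "finite (words I l k)"
proof (rule finite_subset)
  show "words I l k \<subseteq> {u. set u \<subseteq> (\<Union>j\<in>{l..k}. I j) \<and> length u = Suc k - l}"
  proof
    fix u assume u: "u \<in> words I l k"
    have "u ! j \<in> (\<Union>j\<in>{l..k}. I j)" if "j < length u" for j
      using u that by (intro UN_I[of "l + j"]) (auto simp: words_def)
    then have "set u \<subseteq> (\<Union>j\<in>{l..k}. I j)" unfolding set_conv_nth by blast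
    then show "u \<in> {u. set u \<subseteq> (\<Union>j\<in>{l..k}. I j) \<and> length u = Suc k - l}"
      using u by (simp add: words_def)
  qed
  show "finite {u. set u \<subseteq> (\<Union>j\<in>{l..k}. I j) \<and> length u = Suc k - l}"
    using assms by (intro finite_lists_length_eq) auto
qed

lemma word_map_append: "word_map \<psi> l (u @ w) = word_map \<psi> l u \<circ> word_map \<psi> (l + length u) w"
  by (induction u arbitrary: l) (auto simp: comp_assoc)

section \<open>Geometry of a conformal system\<close>

text \<open>
  Fixing the distortion constant \<open>C\<close> and the contraction constant \<open>c\<close> as parameters keeps them the same
  for all levels and words in the estimates below.
\<close>

locale conformal_ifs = nonautonomous_ifs I J \<phi> Js
  for I :: "nat \<Rightarrow> 'i set"
    and J :: "'a::euclidean_space set"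
    and \<phi> :: "nat \<Rightarrow> 'i \<Rightarrow> 'a \<Rightarrow> 'a"
    and Js :: "'i list \<Rightarrow> 'a set" +
  fixes V :: "'a set" and \<psi> :: "nat \<Rightarrow> 'i \<Rightarrow> 'a \<Rightarrow> 'a" and C c :: real
  assumes V: "open V" "connected V" "J \<subseteq> V"
    and extends: "\<lbrakk>k \<ge> 1; i \<in> I k; x \<in> J\<rbrakk> \<Longrightarrow> \<psi> k i x = \<phi> k i x"
    and diffeo: "\<lbrakk>k \<ge> 1; i \<in> I k\<rbrakk> \<Longrightarrow> conformal_diffeo_into V (\<psi> k i)"
    and C_ge_1: "C \<ge> 1"
    and bounded_distortion: "\<lbrakk>1 \<le> l; l \<le> k; u \<in> words I l k; x \<in> V; y \<in> V\<rbrakk> \<Longrightarrow>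
      deriv_norm (word_map \<psi> l u) x \<le> C * deriv_norm (word_map \<psi> l u) y"
    and c: "0 < c" "c < 1"
    and lipschitz: "\<lbrakk>k \<ge> 1; i \<in> I k; x \<in> J; y \<in> J\<rbrakk> \<Longrightarrow> norm (\<phi> k i x - \<phi> k i y) \<le> c * norm (x - y)"
begin

abbreviation W :: "nat \<Rightarrow> 'i list set" where
  "W k \<equiv> words I 1 k"

definition ratio :: "nat \<Rightarrow> 'i list \<Rightarrow> real" where
  "ratio l u = sup_deriv_norm J (word_map \<psi> l u)"

lemma J_nonempty: "J \<noteq> {}"
  using J_interior interior_subset by blast

lemma finite_W [simp]: "finite (W k)" "finite (words I (Suc l) k)"
  using index_finite by (auto intro!: finite_words)

lemma index_nonempty: "k \<ge> 1 \<Longrightarrow> I k \<noteq> {}"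
  using index_card[of k] by fastforce

lemma word_map_V:
  assumes "1 \<le> l" "u \<in> words I l k" "x \<in> V"
  shows "word_map \<psi> l u x \<in> V \<and> conformal_at (word_map \<psi> l u) x"
  using assms
proof (induction u arbitrary: l)
  case (Cons i u)
  then have i: "i \<in> I l" "u \<in> words I (Suc l) k" by (auto simp: words_Cons)
  have IH: "word_map \<psi> (Suc l) u x \<in> V" "conformal_at (word_map \<psi> (Suc l) u) x"
    using Cons.IH[of "Suc l"] Cons.prems i by auto
  have "conformal_diffeo_into V (\<psi> l i)" using diffeo Cons.prems(1) i(1) by blast
  then have "\<psi> l i (word_map \<psi> (Suc l) u x) \<in> V" "conformal_at (\<psi> l i) (word_map \<psi> (Suc l) u x)"
    using IH(1) conformal_diffeo_imp_conformal_at unfolding conformal_diffeo_into_def by blast+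
  then show ?case using conformal_at_compose(1)[OF IH(2)] by (simp add: comp_def)
qed (simp add: conformal_at_id)

lemmas word_map_in_V = word_map_V[THEN conjunct1]
lemmas word_map_conformal = word_map_V[THEN conjunct2]

lemma word_map_inj:
  assumes "1 \<le> l" "u \<in> words I l k"
  shows "inj_on (word_map \<psi> l u) V"
  using assms
proof (induction u arbitrary: l)
  case (Cons i u)
  then have i: "i \<in> I l" "u \<in> words I (Suc l) k" by (auto simp: words_Cons)
  have "inj_on (word_map \<psi> (Suc l) u) V" using Cons.IH[of "Suc l"] i(2) by simp
  moreover have "word_map \<psi> (Suc l) u ` V \<subseteq> V"
    using word_map_in_V[OF _ i(2)] by auto
  moreover have "inj_on (\<psi> l i) V"
    using diffeo[OF Cons.prems(1) i(1)] unfolding conformal_diffeo_into_def by blast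
  ultimately show ?case
    by (simp only: word_map.simps) (metis comp_inj_on inj_on_subset)
qed simp

lemma word_map_J:
  assumes "1 \<le> l" "u \<in> words I l k" "x \<in> J"
  shows "word_map \<psi> l u x \<in> J \<and> word_map \<phi> l u x = word_map \<psi> l u x"
  using assms
proof (induction u arbitrary: l)
  case (Cons i u)
  then have i: "i \<in> I l" "u \<in> words I (Suc l) k" by (auto simp: words_Cons)
  have "word_map \<psi> (Suc l) u x \<in> J" "word_map \<phi> (Suc l) u x = word_map \<psi> (Suc l) u x"
    using Cons.IH[of "Suc l"] Cons.prems(3) i(2) by auto
  then show ?case using maps_into[OF Cons.prems(1) i(1)] extends[OF Cons.prems(1) i(1)] by auto
qed simp

lemma distortion:
  assumes "1 \<le> l" "u \<in> words I l k" "x \<in> V" "y \<in> V"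
  shows "deriv_norm (word_map \<psi> l u) x \<le> C * deriv_norm (word_map \<psi> l u) y"
proof (cases "l \<le> k")
  case False
  then have "u = []" using assms(2) by (simp add: words_def)
  then show ?thesis using C_ge_1 by (simp add: conformal_at_id)
qed (use assms bounded_distortion in blast)

lemma deriv_le_ratio:
  assumes "1 \<le> l" "u \<in> words I l k" "x \<in> J"
  shows "deriv_norm (word_map \<psi> l u) x \<le> ratio l u"
proof -
  have "bdd_above (deriv_norm (word_map \<psi> l u) ` J)"
    using distortion[OF assms(1,2) _ subsetD[OF V(3) assms(3)]] V(3) by (intro bdd_aboveI2) blast
  then show ?thesis unfolding ratio_def sup_deriv_norm_def using assms(3) by (rule cSUP_upper[rotated])
qed

lemma ratio_le:
  assumes "\<And>x. x \<in> J \<Longrightarrow> deriv_norm (word_map \<psi> l u) x \<le> B"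
  shows "ratio l u \<le> B"
  unfolding ratio_def sup_deriv_norm_def using J_nonempty assms by (rule cSUP_least)

lemma ratio_le_deriv:
  assumes "1 \<le> l" "u \<in> words I l k" "y \<in> V"
  shows "ratio l u \<le> C * deriv_norm (word_map \<psi> l u) y"
  using distortion[OF assms(1,2) _ assms(3)] V(3) by (intro ratio_le) auto

lemma deriv_le_C_ratio:
  assumes "1 \<le> l" "u \<in> words I l k" "y \<in> V"
  shows "deriv_norm (word_map \<psi> l u) y \<le> C * ratio l u"
proof -
  obtain x where x: "x \<in> J" using J_nonempty by blast
  then show ?thesis
    using distortion[OF assms subsetD[OF V(3) x]] deriv_le_ratio[OF assms(1,2) x] C_ge_1
    by (meson mult_left_mono order_trans zero_le_one)
qed

lemma ratio_pos:
  assumes "1 \<le> l" "u \<in> words I l k"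
  shows "ratio l u > 0"
proof -
  obtain x where x: "x \<in> J" using J_nonempty by blast
  then show ?thesis
    using deriv_norm_pos[OF word_map_conformal[OF assms]] deriv_le_ratio[OF assms x] V(3) by fastforce
qed

lemma ratio_Nil: "ratio l [] = 1"
  unfolding ratio_def sup_deriv_norm_def using J_nonempty by (simp add: conformal_at_id)

lemma deriv_norm_append:
  assumes "u \<in> W k" "w \<in> words I (Suc k) m" "x \<in> V"
  shows "deriv_norm (word_map \<psi> 1 (u @ w)) x =
    deriv_norm (word_map \<psi> 1 u) (word_map \<psi> (Suc k) w x) * deriv_norm (word_map \<psi> (Suc k) w) x"
  using conformal_at_compose(2)[OF word_map_conformal[OF _ assms(2,3)]
      word_map_conformal[OF _ assms(1) word_map_in_V[OF _ assms(2,3)]]] length_words[OF assms(1)]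
  by (simp add: word_map_append)

lemma ratio_append_le:
  assumes "u \<in> W k" "w \<in> words I (Suc k) m"
  shows "ratio 1 (u @ w) \<le> ratio 1 u * ratio (Suc k) w"
proof (rule ratio_le)
  fix x assume x: "x \<in> J"
  then have "x \<in> V" using V(3) by blast
  show "deriv_norm (word_map \<psi> 1 (u @ w)) x \<le> ratio 1 u * ratio (Suc k) w"
    unfolding deriv_norm_append[OF assms \<open>x \<in> V\<close>]
  proof (rule mult_mono)
    show "deriv_norm (word_map \<psi> 1 u) (word_map \<psi> (Suc k) w x) \<le> ratio 1 u"
      using deriv_le_ratio[OF _ assms(1)] word_map_J[OF _ assms(2) x] by auto
    show "deriv_norm (word_map \<psi> (Suc k) w) x \<le> ratio (Suc k) w"
      using deriv_le_ratio[OF _ assms(2) x] by auto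
    show "0 \<le> ratio 1 u" using ratio_pos[OF _ assms(1)] by simp
    show "0 \<le> deriv_norm (word_map \<psi> (Suc k) w) x"
      using deriv_norm_pos[OF word_map_conformal[OF _ assms(2) \<open>x \<in> V\<close>]] by simp
  qed
qed

lemma ratio_append_ge:
  assumes "u \<in> W k" "w \<in> words I (Suc k) m" "k \<le> m"
  shows "ratio 1 u * ratio (Suc k) w \<le> C * ratio 1 (u @ w)"
proof -
  have pos: "ratio 1 u > 0" using ratio_pos[OF _ assms(1)] by simp
  have "ratio (Suc k) w \<le> C * ratio 1 (u @ w) / ratio 1 u"
  proof (rule ratio_le)
    fix x assume x: "x \<in> J"
    then have "x \<in> V" using V(3) by blast
    have dw: "deriv_norm (word_map \<psi> (Suc k) w) x > 0"
      using deriv_norm_pos[OF word_map_conformal[OF _ assms(2) \<open>x \<in> V\<close>]] by simp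
    have "ratio 1 u * deriv_norm (word_map \<psi> (Suc k) w) x
        \<le> (C * deriv_norm (word_map \<psi> 1 u) (word_map \<psi> (Suc k) w x)) * deriv_norm (word_map \<psi> (Suc k) w) x"
      using ratio_le_deriv[OF _ assms(1) word_map_in_V[OF _ assms(2) \<open>x \<in> V\<close>]] dw
      by (intro mult_right_mono) auto
    also have "\<dots> = C * deriv_norm (word_map \<psi> 1 (u @ w)) x"
      using deriv_norm_append[OF assms(1,2) \<open>x \<in> V\<close>] by simp
    also have "\<dots> \<le> C * ratio 1 (u @ w)"
      using deriv_le_ratio[OF _ words_append[OF assms] x] C_ge_1 by (intro mult_left_mono) auto
    finally show "deriv_norm (word_map \<psi> (Suc k) w) x \<le> C * ratio 1 (u @ w) / ratio 1 u"
      using pos by (simp add: field_simps)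
  qed
  then show ?thesis using pos by (simp add: field_simps)
qed

text \<open>
  Contraction is known for difference quotients in \<open>J\<close> only. It bounds the derivative at interior
  points of \<open>J\<close>, which are dense in \<open>J\<close>, and continuity of the derivative carries the bound to the boundary.
\<close>

lemma ratio_letter_le:
  assumes "k \<ge> 1" "i \<in> I k"
  shows "ratio k [i] \<le> c"
proof (rule ratio_le)
  fix x assume x: "x \<in> J"
  have diff: "conformal_diffeo_into V (\<psi> k i)" by (rule diffeo[OF assms])
  have interior_le: "deriv_norm (\<psi> k i) y \<le> c" if "y \<in> interior J" for y
  proof (rule deriv_norm_le_lipschitz)
    have "y \<in> J" using that interior_subset by blast
    then show "conformal_at (\<psi> k i) y" using conformal_diffeo_imp_conformal_at[OF diff] V(3) by blast
    show "norm (\<psi> k i z - \<psi> k i y) \<le> c * norm (z - y)" if "z \<in> interior J" for z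
    proof -
      have "z \<in> J" using that interior_subset by blast
      then show ?thesis using lipschitz[OF assms] extends[OF assms] \<open>y \<in> J\<close> by simp
    qed
  qed (use that in auto)
  have "continuous_on J (deriv_norm (\<psi> k i))"
    using diff continuous_on_deriv_norm V(3) unfolding conformal_diffeo_into_def
    by (meson continuous_on_subset)
  then have "deriv_norm (\<psi> k i) x \<le> c"
    using continuous_le_on_closure[of "interior J" "deriv_norm (\<psi> k i)" x c] J_regular interior_le x by simp
  then show "deriv_norm (word_map \<psi> k [i]) x \<le> c" by simp
qed

lemma ratio_snoc_le:
  assumes "u \<in> W k" "i \<in> I (Suc k)"
  shows "ratio 1 (u @ [i]) \<le> c * ratio 1 u"
proof -
  have w: "[i] \<in> words I (Suc k) (Suc k)" using assms(2) by (simp add: words_def)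
  have "ratio 1 (u @ [i]) \<le> ratio 1 u * ratio (Suc k) [i]" by (rule ratio_append_le[OF assms(1) w])
  also have "\<dots> \<le> ratio 1 u * c"
    using ratio_letter_le assms ratio_pos[OF _ assms(1)] by (intro mult_left_mono) auto
  finally show ?thesis by (simp add: mult.commute)
qed

lemma W_Suc_cases:
  assumes "u \<in> W (Suc k)"
  obtains v i where "u = v @ [i]" "v \<in> W k" "i \<in> I (Suc k)"
proof (cases u rule: rev_cases)
  case (snoc v i)
  then show thesis using assms that words_snoc by metis
qed (use assms in \<open>simp add: words_def\<close>)

lemma ratio_le_power: "u \<in> W k \<Longrightarrow> ratio 1 u \<le> c ^ k"
proof (induction k arbitrary: u)
  case 0 then show ?case using ratio_Nil by (simp add: words_def)
next
  case (Suc k)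
  from Suc.prems obtain v i where v: "u = v @ [i]" "v \<in> W k" "i \<in> I (Suc k)" by (rule W_Suc_cases)
  then show ?case
    using ratio_snoc_le[OF v(2,3)] Suc.IH[OF v(2)] c(1)
    by (metis mult_left_mono less_imp_le order_trans power_Suc)
qed

lemma W_nonempty: "W k \<noteq> {}"
proof (induction k)
  case 0 show ?case using words_Nil by blast
next
  case (Suc k)
  then show ?case using words_snoc index_nonempty[of "Suc k"] by (metis all_not_in_conv le_add1 plus_1_eq_Suc)
qed

lemma Js_take:
  assumes "v \<in> W m" "k \<le> m"
  shows "Js v \<subseteq> Js (take k v)"
  using assms
proof (induction m arbitrary: v)
  case (Suc m)
  from Suc.prems obtain u i where u: "v = u @ [i]" "u \<in> W m" "i \<in> I (Suc m)" using W_Suc_cases by blast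
  show ?case
  proof (cases "k = Suc m")
    case False
    then have "k \<le> m" using Suc.prems by simp
    moreover have "Js v \<subseteq> Js u" using Js_nested[of "Suc m" u i] u by simp
    ultimately show ?thesis using Suc.IH[OF u(2)] u length_words[OF u(2)] by auto
  qed (use Suc.prems length_words in force)
qed (simp add: words_def)

lemma Js_eq_image:
  assumes "u \<in> W k"
  obtains \<omega> where "Js u = (\<lambda>x. word_map \<psi> 1 u x + \<omega>) ` J"
  using Js_translate[OF assms] word_map_J[OF _ assms] by (metis (no_types, lifting) image_cong le_refl)

lemma Js_nonempty: "u \<in> W k \<Longrightarrow> Js u \<noteq> {}"
  using Js_eq_image J_nonempty by (metis image_is_empty)

lemma Js_compact: "u \<in> W k \<Longrightarrow> compact (Js u)"
  using Js_closed Js_subset J_compact by (metis compact_Int_closed inf.absorb_iff2 inf_commute)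

text \<open>
  The derivative of the map of \<open>u\<close> is at most \<open>C * ratio 1 u\<close> on all of \<open>V\<close>, so one oscillation constant
  of \<open>J\<close> in \<open>V\<close> serves all words.
\<close>

lemma cylinder_diameter:
  obtains L where "L > 0" "\<And>k u x y. u \<in> W k \<Longrightarrow> x \<in> Js u \<Longrightarrow> y \<in> Js u \<Longrightarrow> dist x y \<le> L * ratio 1 u"
proof -
  obtain L where L: "L > 0"
    "\<And>f r x y. \<lbrakk>\<And>z. z \<in> V \<Longrightarrow> conformal_at f z \<and> deriv_norm f z \<le> r; x \<in> J; y \<in> J\<rbrakk>
       \<Longrightarrow> dist (f x) (f y) \<le> L * r"
    using uniform_oscillation[OF V(1,2) J_compact V(3)] by metis
  show thesis
  proof (rule that[of "L * C"])
    show "L * C > 0" using L(1) C_ge_1 by simp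
    fix k u x y assume u: "u \<in> W k" and xy: "x \<in> Js u" "y \<in> Js u"
    obtain \<omega> where "Js u = (\<lambda>x. word_map \<psi> 1 u x + \<omega>) ` J" using Js_eq_image[OF u] .
    then obtain x' y' where "x' \<in> J" "y' \<in> J" "x = word_map \<psi> 1 u x' + \<omega>" "y = word_map \<psi> 1 u y' + \<omega>"
      using xy by blast
    then show "dist x y \<le> L * C * ratio 1 u"
      using L(2)[of "word_map \<psi> 1 u" "C * ratio 1 u" x' y'] word_map_conformal[OF _ u] deriv_le_C_ratio[OF _ u]
      by (simp add: mult.assoc)
  qed
qed

text \<open>The inner balls come from the images of one fixed ball in \<open>J\<close>.\<close>

lemma cylinder_inner_ball:
  obtains b where "b > 0" "\<And>k u. u \<in> W k \<Longrightarrow> \<exists>z. ball z (b * ratio 1 u) \<subseteq> Js u"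
proof -
  obtain a \<rho> where a: "\<rho> > 0" "cball a \<rho> \<subseteq> J"
    using J_interior by (meson all_not_in_conv mem_interior_cball)
  show thesis
  proof (rule that[of "\<rho> / C"])
    show "\<rho> / C > 0" using a(1) C_ge_1 by simp
    fix k u assume u: "u \<in> W k"
    obtain \<omega> where \<omega>: "Js u = (\<lambda>x. word_map \<psi> 1 u x + \<omega>) ` J" using Js_eq_image[OF u] .
    have "ball (word_map \<psi> 1 u a) (ratio 1 u / C * \<rho>) \<subseteq> word_map \<psi> 1 u ` ball a \<rho>"
    proof (rule conformal_image_contains_ball[OF V(1) _ word_map_inj[OF _ u]])
      show "ratio 1 u / C > 0" using ratio_pos[OF _ u] C_ge_1 by simp
      show "conformal_at (word_map \<psi> 1 u) x \<and> ratio 1 u / C \<le> deriv_norm (word_map \<psi> 1 u) x" if "x \<in> V" for x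
        using word_map_conformal[OF _ u that] ratio_le_deriv[OF _ u that] C_ge_1 by (simp add: field_simps)
    qed (use a V(3) in auto)
    also have "\<dots> \<subseteq> word_map \<psi> 1 u ` J" using a(2) ball_subset_cball by blast
    finally have sub: "ball (word_map \<psi> 1 u a) (ratio 1 u / C * \<rho>) \<subseteq> word_map \<psi> 1 u ` J" .
    have "ball (word_map \<psi> 1 u a + \<omega>) (ratio 1 u / C * \<rho>) \<subseteq> Js u"
    proof
      fix y assume "y \<in> ball (word_map \<psi> 1 u a + \<omega>) (ratio 1 u / C * \<rho>)"
      then have "y - \<omega> \<in> ball (word_map \<psi> 1 u a) (ratio 1 u / C * \<rho>)"
        by (simp add: dist_norm algebra_simps)
      then obtain x where "x \<in> J" "y - \<omega> = word_map \<psi> 1 u x" using sub by blast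
      then show "y \<in> Js u" unfolding \<omega> by (auto intro!: image_eqI[of _ _ x] simp: algebra_simps)
    qed
    then show "\<exists>z. ball z (\<rho> / C * ratio 1 u) \<subseteq> Js u" by (auto simp: mult.commute)
  qed
qed

text \<open>
  The open set condition separates two words at the first letter where they differ, and nesting
  passes the disjointness on to all extensions.
\<close>

lemma cylinder_interiors_disjoint:
  assumes "open_set_condition I Js" "u \<in> W k" "v \<in> W k" "u \<noteq> v"
  shows "interior (Js u) \<inter> interior (Js v) = {}"
  using assms(2-)
proof (induction k arbitrary: u v)
  case (Suc k)
  obtain u' i where u: "u = u' @ [i]" "u' \<in> W k" "i \<in> I (Suc k)" using Suc.prems W_Suc_cases by blast
  obtain v' j where v: "v = v' @ [j]" "v' \<in> W k" "j \<in> I (Suc k)" using Suc.prems W_Suc_cases by blast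
  show ?case
  proof (cases "u' = v'")
    case True
    then show ?thesis using assms(1) u v Suc.prems unfolding open_set_condition_def by blast
  next
    case False
    have "Js u \<subseteq> Js u'" "Js v \<subseteq> Js v'" using Js_nested[of "Suc k"] u v by auto
    then show ?thesis using Suc.IH[OF u(2) v(2) False] interior_mono by blast
  qed
qed (auto simp: words_def)

section \<open>The attractor\<close>

lemma attractor_cover:
  assumes "x \<in> attractor I Js"
  shows "\<exists>u\<in>W k. x \<in> Js u"
proof (cases "k = 0")
  case True
  obtain u where "u \<in> W 1" "x \<in> Js u" using assms unfolding attractor_def by auto
  then show ?thesis using True Js_subset words_Nil Js_Nil by blast
next
  case False
  then have "k \<in> {1..}" by simp
  then show ?thesis using assms unfolding attractor_def by blast
qed

lemma attractor_closed: "closed (attractor I Js)"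
  unfolding attractor_def using Js_closed by (intro closed_INT ballI closed_UN) auto

lemma attractor_bounded: "bounded (attractor I Js)"
proof -
  have "attractor I Js \<subseteq> J" using attractor_cover[of _ 0] Js_Nil by (auto simp: words_def)
  then show ?thesis using J_compact compact_imp_bounded bounded_subset by blast
qed

text \<open>
  Every word extends to an infinite one, whose cylinders are nested nonempty compact sets; a point in their
  intersection lies in a cylinder of each level.
\<close>

lemma attractor_meets_cylinder:
  assumes "u \<in> W k"
  shows "attractor I Js \<inter> Js u \<noteq> {}"
proof -
  define s where "s j = (if j < k then u ! j else SOME i. i \<in> I (Suc j))" for j
  define v where "v m = map s [0..<m]" for m
  have s: "s j \<in> I (Suc j)" for j
    using assms index_nonempty[of "Suc j"] by (auto simp: s_def words_def some_in_eq)
  have v: "v m \<in> W m" for m using s by (auto simp: v_def words_def)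
  have take_v: "take m (v n) = v m" if "m \<le> n" for m n
    using that by (auto simp: v_def take_map)
  have vk: "v k = u" using length_words[OF assms] by (auto simp: v_def s_def intro: nth_equalityI)
  have "\<Inter>(range (\<lambda>m. Js (v m))) \<noteq> {}"
  proof (rule compact_nest)
    show "Js (v n) \<subseteq> Js (v m)" if "m \<le> n" for m n
      using Js_take[OF v that] take_v[OF that] by simp
  qed (use v Js_compact Js_nonempty in blast)+
  then obtain x where x: "\<And>m. x \<in> Js (v m)" by blast
  then have "x \<in> attractor I Js" unfolding attractor_def using v by blast
  then show ?thesis using x[of k] vk by blast
qed

end

section \<open>Separated points in many disjoint pieces\<close>

lemma card_disjoint_balls_le:
  fixes z :: "'v \<Rightarrow> 'a::euclidean_space"
  assumes "finite N" "r > 0" "R \<ge> 0"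
    and disj: "disjoint_family_on (\<lambda>v. ball (z v) r) N"
    and near: "\<And>v. v \<in> N \<Longrightarrow> dist a (z v) < R"
  shows "real (card N) * r ^ DIM('a) \<le> (R + r) ^ DIM('a)"
proof -
  let ?d = "DIM('a)"
  have "unit_ball_vol (real ?d) * (real (card N) * r ^ ?d) = (\<Sum>v\<in>N. measure lborel (ball (z v) r))"
    using \<open>r > 0\<close> by (simp add: content_ball)
  also have "\<dots> = measure lborel (\<Union>v\<in>N. ball (z v) r)"
    using assms(1) disj emeasure_lborel_ball_finite
    by (intro measure_finite_Union[symmetric]) (auto simp: less_top[symmetric])
  also have "\<dots> \<le> measure lborel (ball a (R + r))"
  proof (rule measure_mono_fmeasurable)
    show "(\<Union>v\<in>N. ball (z v) r) \<subseteq> ball a (R + r)"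
    proof clarify
      fix v x assume "v \<in> N" "x \<in> ball (z v) r"
      then show "x \<in> ball a (R + r)" using near[of v] dist_triangle[of a x "z v"] by auto
    qed
    show "ball a (R + r) \<in> fmeasurable lborel" 
      unfolding fmeasurable_def using emeasure_lborel_ball_finite[of a "R + r"] by simp
    show "(\<Union>v\<in>N. ball (z v) r) \<in> sets lborel" by (simp add: open_UN borel_open)
  qed
  also have "\<dots> = unit_ball_vol (real ?d) * (R + r) ^ ?d"
    using \<open>r > 0\<close> \<open>R \<ge> 0\<close> by (simp add: content_ball)
  finally show ?thesis by (simp add: unit_ball_vol_pos)
qed

text \<open>
  A maximal separated subfamily: every centre is near one of its members, and by volume only boundedly many centres
  are near any given one.
\<close>

lemma separated_subfamily:
  fixes z :: "'v \<Rightarrow> 'a::euclidean_space"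
  assumes "finite N" "r > 0" "q > 0"
    and disj: "disjoint_family_on (\<lambda>v. ball (z v) r) N"
  obtains M where "M \<subseteq> N" "\<And>v w. v \<in> M \<Longrightarrow> w \<in> M \<Longrightarrow> v \<noteq> w \<Longrightarrow> q * r \<le> dist (z v) (z w)"
    "real (card N) \<le> (q + 1) ^ DIM('a) * real (card M)"
proof -
  let ?sep = "\<lambda>M. M \<subseteq> N \<and> (\<forall>v\<in>M. \<forall>w\<in>M. v \<noteq> w \<longrightarrow> q * r \<le> dist (z v) (z w))"
  have "finite (Collect ?sep)"
    by (rule finite_subset[of _ "Pow N"]) (use assms(1) in auto)
  moreover have "Collect ?sep \<noteq> {}" by blast
  ultimately have "\<exists>M\<in>Collect ?sep. \<forall>M'\<in>Collect ?sep. M \<subseteq> M' \<longrightarrow> M = M'"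
    by (rule finite_has_maximal)
  then obtain M where Msep: "M \<in> Collect ?sep" and max: "\<forall>M'\<in>Collect ?sep. M \<subseteq> M' \<longrightarrow> M = M'"
    by (rule bexE)
  then have M: "?sep M" by (intro CollectD[OF Msep])
  have cover: "\<exists>w\<in>M. dist (z w) (z v) < q * r" if "v \<in> N" for v
  proof (rule ccontr)
    assume no: "\<not> ?thesis"
    then have "?sep (insert v M)" using M that by (auto simp: dist_commute not_less)
    then have "insert v M \<in> Collect ?sep" by (rule CollectI)
    from max[rule_format, OF this] have "v \<in> M" by blast
    with no have "\<not> 0 < q * r" by force
    then show False using assms(2,3) by simp
  qed
  have local: "real (card {v\<in>N. dist (z w) (z v) < q * r}) \<le> (q + 1) ^ DIM('a)" if "w \<in> M" for w
  proof -
    have "real (card {v\<in>N. dist (z w) (z v) < q * r}) * r ^ DIM('a) \<le> (q * r + r) ^ DIM('a)"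
      using assms by (intro card_disjoint_balls_le[where z = z and a = "z w"]) (auto simp: disjoint_family_on_def)
    also have "\<dots> = (q + 1) ^ DIM('a) * r ^ DIM('a)"
      by (simp add: distrib_right flip: power_mult_distrib)
    finally show ?thesis using \<open>r > 0\<close> by simp
  qed
  have "finite M" by (rule finite_subset[OF conjunct1[OF M] assms(1)])
  have "N \<subseteq> (\<Union>w\<in>M. {v\<in>N. dist (z w) (z v) < q * r})"
    using cover by blast
  then have "card N \<le> card (\<Union>w\<in>M. {v\<in>N. dist (z w) (z v) < q * r})"
    using assms(1) \<open>finite M\<close> by (intro card_mono) auto
  also have "\<dots> \<le> (\<Sum>w\<in>M. card {v\<in>N. dist (z w) (z v) < q * r})"
    using \<open>finite M\<close> by (rule card_UN_le)
  finally have "real (card N) \<le> (\<Sum>w\<in>M. real (card {v\<in>N. dist (z w) (z v) < q * r}))"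
    by (simp flip: of_nat_sum)
  also have "\<dots> \<le> (\<Sum>w\<in>M. (q + 1) ^ DIM('a))" using local by (intro sum_mono)
  finally have "real (card N) \<le> (q + 1) ^ DIM('a) * real (card M)" by (simp add: mult.commute)
  moreover have "q * r \<le> dist (z v) (z w)" if "v \<in> M" "w \<in> M" "v \<noteq> w" for v w
    using M that by blast
  ultimately show thesis using M by (intro that[of M]) auto
qed

section \<open>The pressure bounds the packing dimension from below\<close>

context conformal_ifs
begin

definition level_sum :: "nat \<Rightarrow> real \<Rightarrow> real" where
  "level_sum k t = (\<Sum>u\<in>W k. ratio 1 u powr t)"

lemma upper_pressure_level_sum:
  "upper_pressure I J \<psi> t = limsup (\<lambda>k. ereal (1 / real k * ln (level_sum k t)))"
  by (simp add: upper_pressure_def level_sum_def ratio_def)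

lemma level_sum_pos: "level_sum k t > 0"
  unfolding level_sum_def using W_nonempty ratio_pos by (intro sum_pos) fastforce+

text \<open>
  The maps beyond level \<open>l\<close> do not depend on the prefix, and bounded distortion makes the ratio of a
  concatenation comparable to the product of the ratios. So the sum over the
  extensions of one fixed word is at least a constant multiple of the full sum.
\<close>

lemma extension_sum_ge:
  assumes "u \<in> W l" "l \<le> k" "t \<ge> 0"
  shows "(ratio 1 u / C) powr t * level_sum k t \<le>
    level_sum l t * (\<Sum>w\<in>words I (Suc l) k. ratio 1 (u @ w) powr t)"
proof -
  let ?D = "words I (Suc l) k"
  define A where "A = (\<Sum>w\<in>?D. ratio (Suc l) w powr t)"
  have pos: "ratio (Suc l) w > 0" if "w \<in> ?D" for w using ratio_pos that by simp
  have W: "W k = (\<lambda>(v, w). v @ w) ` (W l \<times> ?D)"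
  proof
    show "W k \<subseteq> (\<lambda>(v, w). v @ w) ` (W l \<times> ?D)"
    proof
      fix v assume v: "v \<in> W k"
      show "v \<in> (\<lambda>(v, w). v @ w) ` (W l \<times> ?D)"
        using words_take[OF v assms(2)] words_drop[OF v assms(2)]
        by (intro image_eqI[of _ _ "(take l v, drop l v)"]) auto
    qed
    show "(\<lambda>(v, w). v @ w) ` (W l \<times> ?D) \<subseteq> W k"
      using words_append[OF _ _ assms(2)] by auto
  qed
  have inj: "inj_on (\<lambda>(v, w). v @ w) (W l \<times> ?D)"
  proof (rule inj_onI, clarify)
    fix v w v' w' assume "v \<in> W l" "v' \<in> W l" "v @ w = v' @ w'"
    then show "v = v' \<and> w = w'" using length_words by (metis append_eq_append_conv)
  qed
  have "level_sum k t = (\<Sum>(v, w)\<in>W l \<times> ?D. ratio 1 (v @ w) powr t)"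
    unfolding level_sum_def W by (subst sum.reindex[OF inj]) (simp add: case_prod_unfold)
  also have "\<dots> \<le> (\<Sum>(v, w)\<in>W l \<times> ?D. ratio 1 v powr t * ratio (Suc l) w powr t)"
  proof (intro sum_mono, clarify)
    fix v w assume v: "v \<in> W l" "w \<in> ?D"
    have "ratio 1 (v @ w) powr t \<le> (ratio 1 v * ratio (Suc l) w) powr t"
      using ratio_append_le[OF v] ratio_pos[OF _ words_append[OF v assms(2)]] assms(3)
      by (intro powr_mono2) auto
    then show "ratio 1 (v @ w) powr t \<le> ratio 1 v powr t * ratio (Suc l) w powr t"
      using pos[OF v(2)] ratio_pos[OF _ v(1)] by (simp add: powr_mult)
  qed
  also have "\<dots> = level_sum l t * A"
    by (simp add: level_sum_def A_def sum_product sum.cartesian_product)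
  finally have "(ratio 1 u / C) powr t * level_sum k t \<le> (ratio 1 u / C) powr t * (level_sum l t * A)"
    by (intro mult_left_mono) auto
  also have "\<dots> = level_sum l t * (\<Sum>w\<in>?D. (ratio 1 u / C) powr t * ratio (Suc l) w powr t)"
    by (simp add: A_def sum_distrib_left mult_ac)
  also have "\<dots> \<le> level_sum l t * (\<Sum>w\<in>?D. ratio 1 (u @ w) powr t)"
  proof (intro mult_left_mono sum_mono)
    fix w assume w: "w \<in> ?D"
    have "(ratio 1 u / C) powr t * ratio (Suc l) w powr t = (ratio 1 u / C * ratio (Suc l) w) powr t"
      by (simp only: powr_mult)
    also have "\<dots> \<le> ratio 1 (u @ w) powr t"
      using ratio_append_ge[OF assms(1) w assms(2)] C_ge_1 ratio_pos[OF _ assms(1)] pos[OF w] assms(3)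
      by (intro powr_mono2) (auto simp: field_simps)
    finally show "(ratio 1 u / C) powr t * ratio (Suc l) w powr t \<le> ratio 1 (u @ w) powr t" .
  qed (use level_sum_pos less_imp_le in auto)
  finally show ?thesis .
qed

text \<open>
  Ratios at level \<open>k\<close> are at most \<open>c ^ k\<close>, so lowering the exponent from \<open>t'\<close> to \<open>t\<close> multiplies each term of the
  level sum by at least \<open>exp (2 * e * k)\<close>, with \<open>e\<close> as defined in the proof. Nonnegative pressure at \<open>t'\<close> gives infinitely many
  levels on which the sum at \<open>t'\<close> exceeds \<open>exp (- e * k)\<close>, which leaves exponential growth at \<open>t\<close>.
\<close>

lemma level_sum_unbounded:
  assumes "t < t'" "\<not> upper_pressure I J \<psi> t' < 0"
  shows "\<exists>k\<ge>k0. B < level_sum k t"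
proof -
  define e where "e = (t' - t) * (- ln c) / 2"
  have e: "e > 0" using assms(1) c unfolding e_def by (intro divide_pos_pos mult_pos_pos) auto
  obtain k1 :: nat where k1: "B / e < real k1" using reals_Archimedean2 by blast
  define k2 where "k2 = max (max k0 k1) 1"
  have "\<exists>k\<ge>k2. - e < 1 / real k * ln (level_sum k t')"
  proof (rule ccontr)
    assume "\<not> ?thesis"
    then have "eventually (\<lambda>k. ereal (1 / real k * ln (level_sum k t')) \<le> ereal (- e)) sequentially"
      unfolding eventually_sequentially by (auto simp: not_less)
    then have "upper_pressure I J \<psi> t' \<le> ereal (- e)"
      unfolding upper_pressure_level_sum by (rule Limsup_bounded)
    also have "\<dots> < 0" using e by simp
    finally show False using assms(2) by simp
  qed
  then obtain k where k: "k \<ge> k2" "- e < 1 / real k * ln (level_sum k t')" by blast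
  then have "k \<ge> 1" "k \<ge> k1" "k \<ge> k0" by (auto simp: k2_def)
  then have "- e * real k < ln (level_sum k t')" using k(2) by (simp add: field_simps)
  then have large: "exp (- e * real k) < level_sum k t'"
    using level_sum_pos by (metis exp_less_mono exp_ln)
  have "B < e * real k1" using k1 e by (simp add: field_simps)
  also have "\<dots> \<le> e * real k" using \<open>k \<ge> k1\<close> e by simp
  also have "\<dots> < exp (e * real k)" using exp_ge_add_one_self[of "e * real k"] by linarith
  also have "exp (e * real k) = exp (- e * real k) * exp (2 * e * real k)"
    by (simp flip: exp_add add: algebra_simps)
  also have "\<dots> \<le> level_sum k t' * exp (2 * e * real k)" using large by (intro mult_right_mono) auto
  also have "\<dots> \<le> level_sum k t"
    unfolding level_sum_def sum_distrib_right
  proof (rule sum_mono)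
    fix u assume u: "u \<in> W k"
    have pos: "ratio 1 u > 0" using ratio_pos[OF _ u] by simp
    have "2 * e = (t' - t) * (- ln c)" by (simp add: e_def)
    then have "2 * e * real k = (t' - t) * (- ln c) * real k" by (simp only:)
    also have "\<dots> = (t - t') * (real k * ln c)" by (simp add: algebra_simps)
    finally have "exp (2 * e * real k) = (c ^ k) powr (t - t')"
      using c by (simp add: powr_def ln_realpow)
    also have "\<dots> \<le> ratio 1 u powr (t - t')"
      using assms(1) ratio_le_power[OF u] pos c by (intro powr_mono2') auto
    finally have "ratio 1 u powr t' * exp (2 * e * real k) \<le> ratio 1 u powr t' * ratio 1 u powr (t - t')"
      by (intro mult_left_mono) auto
    then show "ratio 1 u powr t' * exp (2 * e * real k) \<le> ratio 1 u powr t"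
      by (simp flip: powr_add)
  qed
  finally show ?thesis using \<open>k \<ge> k0\<close> by blast
qed

text \<open>
  The sum over the extensions of a word cannot be large unless many of the extensions have comparable
  ratios. Each of those contributes an inner ball, disjoint from the others, and a point of the attractor
  nearby; a separated subfamily of the balls gives separated points.
\<close>

lemma attractor_separated_points:
  assumes osc: "open_set_condition I Js"
    and st: "0 \<le> s" "s < t" and unbounded: "\<And>k0 B. \<exists>k\<ge>k0. B < level_sum k t"
    and x: "x \<in> attractor I Js" and "e > 0" "\<delta> > 0"
  shows "\<exists>X \<rho>. finite X \<and> X \<subseteq> attractor I Js \<inter> ball x e \<and> 0 < \<rho> \<and> \<rho> \<le> \<delta> \<and>
    (\<forall>a\<in>X. \<forall>b\<in>X. a \<noteq> b \<longrightarrow> 3 * \<rho> \<le> dist a b) \<and> 1 \<le> real (card X) * \<rho> powr s"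
proof -
  obtain L where L: "L > 0" "\<And>k u x y. u \<in> W k \<Longrightarrow> x \<in> Js u \<Longrightarrow> y \<in> Js u \<Longrightarrow> dist x y \<le> L * ratio 1 u"
    using cylinder_diameter by metis
  obtain b where b: "b > 0" "\<And>k u. u \<in> W k \<Longrightarrow> \<exists>z. ball z (b * ratio 1 u) \<subseteq> Js u"
    using cylinder_inner_ball by metis
  obtain l where l: "c ^ l < e / L" using real_arch_pow_inv[of "e / L" c] c L(1) \<open>e > 0\<close> by auto
  obtain u where u: "u \<in> W l" "x \<in> Js u" using attractor_cover[OF x] by blast
  have Js_u: "Js u \<subseteq> ball x e"
  proof
    fix y assume "y \<in> Js u"
    then have "dist x y \<le> L * ratio 1 u" using L(2) u by blast
    also have "\<dots> \<le> L * c ^ l" using ratio_le_power[OF u(1)] L(1) by simp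
    also have "\<dots> < e" using l L(1) by (simp add: field_simps)
    finally show "y \<in> ball x e" by simp
  qed
  \<comment> \<open>In units of \<open>\<rho>\<close>, a point of a cylinder is within \<open>L\<close> of the centre of its inner ball,
    whose radius is at least \<open>b / 2\<close>; \<open>q\<close> of these radii make \<open>3 + 2 * L\<close>.\<close>
  define q where "q = (3 + 2 * L) * 2 / b"
  have q: "q > 0" using L(1) b(1) by (simp add: q_def)
  define Q where "Q = (q + 1) ^ DIM('a)"
  have "Q > 0" using q by (simp add: Q_def)
  obtain k1 where k1: "c ^ k1 < \<delta> / 2" using real_arch_pow_inv[of "\<delta> / 2" c] c \<open>\<delta> > 0\<close> by auto
  define bound where "bound = Q / (1 - (1/2) powr (t - s))"
  define a where "a = (ratio 1 u / C) powr t"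
  have a: "a > 0" using ratio_pos[OF _ u(1)] C_ge_1 by (simp add: a_def)
  obtain k where k: "k \<ge> max l k1" "bound * level_sum l t / a < level_sum k t"
    using unbounded by blast
  then have lk: "l \<le> k" and "k1 \<le> k" by auto
  let ?D = "words I (Suc l) k"
  define r where "r w = ratio 1 (u @ w)" for w
  have ext: "u @ w \<in> W k" if "w \<in> ?D" for w using words_append[OF u(1) that lk] .
  have r: "0 < r w" "r w \<le> c ^ k" if "w \<in> ?D" for w
    using ratio_pos[OF _ ext[OF that]] ratio_le_power[OF ext[OF that]] by (auto simp: r_def)
  have "bound * level_sum l t < a * level_sum k t"
    using k(2) a by (simp add: field_simps)
  also have "\<dots> \<le> level_sum l t * (\<Sum>w\<in>?D. r w powr t)"
    using extension_sum_ge[OF u(1) lk] st by (simp add: a_def r_def)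
  finally have large: "bound < (\<Sum>w\<in>?D. r w powr t)"
    using level_sum_pos[of l t] by (simp add: mult.commute)
  have "\<exists>n. Q * ((1/2) ^ n) powr (-s) < real (card (dyadic_class r ?D n))"
  proof (rule ccontr)
    assume few: "\<not> ?thesis"
    have "(\<Sum>w\<in>?D. r w powr t) \<le> bound"
      unfolding bound_def
    proof (rule dyadic_sum_bound)
      show "0 < r w \<and> r w \<le> 1" if "w \<in> ?D" for w
        using r[OF that] power_le_one[of c k] c by linarith
    qed (use few st in \<open>auto simp: not_less\<close>)
    with large show False by simp
  qed
  then obtain n where n: "Q * ((1/2) ^ n) powr (-s) < real (card (dyadic_class r ?D n))" by blast
  define \<rho> :: real where "\<rho> = (1/2) ^ n"
  have "\<rho> > 0" by (simp add: \<rho>_def)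
  define N where "N = dyadic_class r ?D n"
  have "finite N" by (simp add: N_def dyadic_class_def)
  have N: "w \<in> ?D" "\<rho> / 2 < r w" "r w \<le> \<rho>" if "w \<in> N" for w
    using that by (auto simp: N_def dyadic_class_def \<rho>_def)
  have "N \<noteq> {}"
  proof
    assume "N = {}"
    then have "Q * ((1/2) ^ n) powr (-s) < 0" using n by (simp add: N_def)
    moreover have "0 \<le> Q * ((1/2) ^ n) powr (-s)" using \<open>Q > 0\<close> by simp
    ultimately show False by linarith
  qed
  then obtain w0 where w0: "w0 \<in> N" by blast
  have "\<rho> < 2 * c ^ k" using N(2)[OF w0] r(2)[OF N(1)[OF w0]] by linarith
  also have "\<dots> \<le> 2 * c ^ k1" using c \<open>k1 \<le> k\<close> by (intro mult_left_mono power_decreasing) auto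
  also have "\<dots> \<le> \<delta>" using k1 by simp
  finally have "\<rho> \<le> \<delta>" by simp
  have "\<forall>w\<in>N. \<exists>z. ball z (b * r w) \<subseteq> Js (u @ w)"
    using b(2) ext N(1) unfolding r_def by blast
  then obtain z where z: "\<And>w. w \<in> N \<Longrightarrow> ball (z w) (b * r w) \<subseteq> Js (u @ w)" by metis
  have zJ: "z w \<in> Js (u @ w)" if "w \<in> N" for w
    using z[OF that] r(1)[OF N(1)[OF that]] b(1) by (auto simp: subset_iff)
  have "\<forall>w\<in>N. \<exists>y. y \<in> attractor I Js \<inter> Js (u @ w)"
    using attractor_meets_cylinder ext N(1) by blast
  then obtain y where y: "\<And>w. w \<in> N \<Longrightarrow> y w \<in> attractor I Js \<and> y w \<in> Js (u @ w)" by (metis IntD1 IntD2)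
  have yz: "dist (y w) (z w) \<le> L * \<rho>" if w: "w \<in> N" for w
  proof -
    have "dist (y w) (z w) \<le> L * r w" using L(2)[OF ext[OF N(1)[OF w]]] y[OF w] zJ[OF w] unfolding r_def by blast
    also have "\<dots> \<le> L * \<rho>" using N(3)[OF w] L(1) by simp
    finally show ?thesis .
  qed
  define r0 where "r0 = b * \<rho> / 2"
  have "r0 > 0" using b(1) \<open>\<rho> > 0\<close> by (simp add: r0_def)
  have "disjoint_family_on (\<lambda>w. ball (z w) r0) N"
    unfolding disjoint_family_on_def
  proof (intro ballI impI)
    fix v w assume vw: "v \<in> N" "w \<in> N" "v \<noteq> w"
    have "ball (z w) r0 \<subseteq> interior (Js (u @ w))" if "w \<in> N" for w
    proof (rule interior_maximal)
      have "r0 \<le> b * r w" using N(2)[OF that] b(1) by (simp add: r0_def)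
      then show "ball (z w) r0 \<subseteq> Js (u @ w)" using z[OF that] subset_ball by blast
    qed simp
    then show "ball (z v) r0 \<inter> ball (z w) r0 = {}"
      using cylinder_interiors_disjoint[OF osc ext[OF N(1)[OF vw(1)]] ext[OF N(1)[OF vw(2)]]] vw by blast
  qed
  then obtain M where M: "M \<subseteq> N" "\<And>v w. v \<in> M \<Longrightarrow> w \<in> M \<Longrightarrow> v \<noteq> w \<Longrightarrow> q * r0 \<le> dist (z v) (z w)"
    "real (card N) \<le> Q * real (card M)"
    unfolding Q_def using separated_subfamily[OF \<open>finite N\<close> \<open>r0 > 0\<close> q] by metis
  have qr0: "q * r0 = (3 + 2 * L) * \<rho>" using b(1) by (simp add: q_def r0_def)
  have far: "3 * \<rho> \<le> dist (y v) (y w)" if vw: "v \<in> M" "w \<in> M" "v \<noteq> w" for v w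
  proof -
    have "(3 + 2 * L) * \<rho> \<le> dist (z v) (z w)" using M(2)[OF vw] qr0 by simp
    also have "\<dots> \<le> dist (y v) (z v) + dist (y v) (y w) + dist (y w) (z w)"
      using dist_triangle[of "z v" "z w" "y v"] dist_triangle[of "y v" "z w" "y w"] by (simp add: dist_commute)
    also have "\<dots> \<le> L * \<rho> + dist (y v) (y w) + L * \<rho>"
      using yz vw M(1) by (intro add_mono) auto
    finally show ?thesis by (simp add: algebra_simps)
  qed
  have "inj_on y M" using far \<open>\<rho> > 0\<close> by (force simp: inj_on_def)
  then have card: "card (y ` M) = card M" by (rule card_image)
  have "Q * \<rho> powr (-s) < Q * real (card M)" using n M(3) by (simp add: N_def \<rho>_def)
  then have "\<rho> powr (-s) < real (card M)" using \<open>Q > 0\<close> by simp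
  then have "1 \<le> real (card M) * \<rho> powr s" using \<open>\<rho> > 0\<close> by (simp add: powr_minus field_simps)
  moreover have "y ` M \<subseteq> attractor I Js \<inter> ball x e"
  proof
    fix p assume "p \<in> y ` M"
    then obtain w where w: "w \<in> N" "p = y w" using M(1) by blast
    have "Js (u @ w) \<subseteq> Js u"
      using Js_take[OF ext[OF N(1)[OF w(1)]] lk] length_words[OF u(1)] by simp
    then show "p \<in> attractor I Js \<inter> ball x e" using y[OF w(1)] w(2) Js_u by blast
  qed
  moreover have "finite (y ` M)" using M(1) \<open>finite N\<close> finite_subset by blast
  ultimately show ?thesis
    using far \<open>\<rho> > 0\<close> \<open>\<rho> \<le> \<delta>\<close> card by (intro exI[of _ "y ` M"] exI[of _ \<rho>]) auto
qed

theorem pressure_zero_le_packing_dim: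
  assumes "open_set_condition I Js"
  shows "pressure_zero I J \<psi> \<le> packing_dim (attractor I Js)"
proof (rule packing_dim_geI)
  fix s assume s: "0 \<le> s" "ereal s < pressure_zero I J \<psi>"
  then obtain t' where t': "s < t'" "ereal t' < pressure_zero I J \<psi>"
    using ereal_dense2[OF s(2)] by auto
  define t where "t = (s + t') / 2"
  have t: "s < t" "t < t'" using t' by (auto simp: t_def)
  have "\<not> upper_pressure I J \<psi> t' < 0"
  proof
    assume "upper_pressure I J \<psi> t' < 0"
    then have "pressure_zero I J \<psi> \<le> ereal t'"
      unfolding pressure_zero_def by (intro Inf_lower) auto
    with t'(2) show False by simp
  qed
  then have unbounded: "\<exists>k\<ge>k0. B < level_sum k t" for k0 B by (rule level_sum_unbounded[OF t(2)])
  have "attractor I Js \<noteq> {}" using attractor_meets_cylinder[OF words_Nil] by blast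
  then show "packing_measure s (attractor I Js) \<noteq> 0"
    using attractor_closed s(1) attractor_separated_points[OF assms s(1) t(1) unbounded]
    by (intro packing_measure_nonzeroI)
qed

end

section \<open>The pressure bounds the upper box dimension from above\<close>

context conformal_ifs
begin

lemma level_ratio_ge:
  assumes "k \<ge> 1" "ln (min_level_ratio I J \<psi> k) / ln (max_ratio I J \<psi> k) < \<epsilon>"
    and "0 \<le> \<epsilon>" "v \<in> W k" "i \<in> I k"
  shows "ratio 1 v powr \<epsilon> \<le> ratio k [i]"
proof -
  define m where "m = min_level_ratio I J \<psi> k"
  define M where "M = max_ratio I J \<psi> k"
  have letter: "ratio k [j] = sup_deriv_norm J (\<psi> k j)" for j by (simp add: ratio_def)
  have m: "m = Min ((\<lambda>j. ratio k [j]) ` I k)"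
    unfolding m_def min_level_ratio_def letter using index_finite[OF assms(1)] index_nonempty[OF assms(1)]
    by (intro cInf_eq_Min) auto
  have M: "M = Max (ratio 1 ` W k)"
    unfolding M_def max_ratio_def ratio_def using W_nonempty by (intro cSup_eq_Max) auto
  have "m \<in> (\<lambda>j. ratio k [j]) ` I k"
    unfolding m using index_finite[OF assms(1)] index_nonempty[OF assms(1)] by (intro Min_in) auto
  then obtain j where j: "j \<in> I k" "m = ratio k [j]" by blast
  have "[j] \<in> words I k k" using j(1) by (simp add: words_def)
  then have "m > 0" unfolding j(2) using ratio_pos[OF assms(1)] by blast
  have "M \<in> ratio 1 ` W k" unfolding M using W_nonempty by (intro Max_in) auto
  then obtain w where w: "w \<in> W k" "M = ratio 1 w" by blast
  have "c ^ k < 1" using c assms(1) by (simp add: power_less_one_iff)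
  then have "0 < M" "M < 1"
    unfolding w(2) using ratio_pos[OF _ w(1)] ratio_le_power[OF w(1)] by auto
  then have "ln M < 0" by simp
  have "ratio 1 v \<le> M" unfolding M using assms(4) by (intro Max_ge) auto
  have "\<epsilon> * ln (ratio 1 v) \<le> \<epsilon> * ln M"
    using \<open>ratio 1 v \<le> M\<close> ratio_pos[OF _ assms(4)] assms(3) by (intro mult_left_mono) auto
  also have "\<epsilon> * ln M < ln m"
    using assms(2) \<open>ln M < 0\<close> unfolding m_def[symmetric] M_def[symmetric] by (simp add: neg_divide_less_eq)
  finally have "ratio 1 v powr \<epsilon> < m"
    using ratio_pos[OF _ assms(4)] \<open>m > 0\<close> by (simp add: powr_def flip: ln_exp) (metis exp_less_mono exp_ln)
  also have "m \<le> ratio k [i]" unfolding m using index_finite[OF assms(1)] assms(5) by (intro Min_le) auto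
  finally show ?thesis by simp
qed

text \<open>For \<open>t \<le> 0\<close> every level sum is at least \<open>1\<close>, which excludes a negative pressure.\<close>

lemma level_sum_summable:
  assumes "upper_pressure I J \<psi> t < 0"
  shows "t > 0" "summable (\<lambda>k. level_sum k t)"
proof -
  obtain e where e: "upper_pressure I J \<psi> t < ereal e" "ereal e < 0"
    using ereal_dense2[OF assms] by auto
  have "eventually (\<lambda>k. ereal (1 / real k * ln (level_sum k t)) < ereal e) sequentially"
    using e(1) unfolding upper_pressure_level_sum by (rule Limsup_lessD)
  then obtain k0 where k0: "\<And>k. k \<ge> k0 \<Longrightarrow> 1 / real k * ln (level_sum k t) < e"
    unfolding eventually_sequentially by auto
  have small: "level_sum k t < exp e ^ k" if "k \<ge> max k0 1" for k
  proof -
    have "ln (level_sum k t) < e * real k" using k0[of k] that by (simp add: field_simps)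
    then have "level_sum k t < exp (e * real k)" using level_sum_pos by (metis exp_less_mono exp_ln)
    then show ?thesis by (simp add: exp_of_nat2_mult)
  qed
  show "summable (\<lambda>k. level_sum k t)"
  proof (rule summable_comparison_test'[of "\<lambda>k. exp e ^ k" "max k0 1"])
    show "summable (\<lambda>k. exp e ^ k)" using e(2) by (intro summable_geometric) auto
    show "norm (level_sum k t) \<le> exp e ^ k" if "k \<ge> max k0 1" for k
      using small[OF that] level_sum_pos[of k t] by simp
  qed
  show "t > 0"
  proof (rule ccontr)
    assume "\<not> t > 0"
    define k where "k = max k0 1"
    obtain u where u: "u \<in> W k" using W_nonempty by blast
    have "ratio 1 u \<le> 1" using ratio_le_power[OF u] c power_le_one[of c k] by linarith
    then have "1 \<le> ratio 1 u powr t"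
      using \<open>\<not> t > 0\<close> ratio_pos[OF _ u] powr_mono2'[of t "ratio 1 u" 1] by simp
    also have "\<dots> \<le> level_sum k t"
      unfolding level_sum_def by (rule member_le_sum[OF u]) auto
    also have "\<dots> < exp e ^ k" using small by (simp add: k_def)
    also have "\<dots> \<le> 1" using e(2) by (intro power_le_one) auto
    finally show False by simp
  qed
qed

text \<open>
  Ratios decrease along prefixes, so these are the words at which the ratio first drops to \<open>\<delta>\<close>
  or below.
\<close>

definition cut_set :: "real \<Rightarrow> 'i list set" where
  "cut_set \<delta> = {u. \<exists>k. u \<in> W (Suc k) \<and> ratio 1 u \<le> \<delta> \<and> \<delta> < ratio 1 (take k u)}"

lemma cut_set_finite:
  assumes "\<delta> > 0"
  shows "\<exists>m. cut_set \<delta> \<subseteq> (\<Union>k\<in>{..m}. W k)" "finite (cut_set \<delta>)"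
proof -
  obtain m where m: "c ^ m < \<delta>" using real_arch_pow_inv[OF assms c(2)] by auto
  have "cut_set \<delta> \<subseteq> (\<Union>k\<in>{..m}. W k)"
  proof
    fix u assume "u \<in> cut_set \<delta>"
    then obtain k where k: "u \<in> W (Suc k)" "\<delta> < ratio 1 (take k u)" by (auto simp: cut_set_def)
    have "ratio 1 (take k u) \<le> c ^ k" using ratio_le_power words_take[OF k(1)] by simp
    then have "c ^ m < c ^ k" using m k(2) by linarith
    then have "k < m" using c by (metis not_less power_decreasing less_imp_le)
    then show "u \<in> (\<Union>k\<in>{..m}. W k)" using k(1) by (intro UN_I[of "Suc k"]) auto
  qed
  then show "\<exists>m. cut_set \<delta> \<subseteq> (\<Union>k\<in>{..m}. W k)" by blast
  show "finite (cut_set \<delta>)"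
    by (rule finite_subset[OF \<open>cut_set \<delta> \<subseteq> _\<close>]) auto
qed

lemma cut_set_sum_le:
  assumes "\<delta> > 0" "summable (\<lambda>k. level_sum k t)"
  shows "(\<Sum>u\<in>cut_set \<delta>. ratio 1 u powr t) \<le> (\<Sum>k. level_sum k t)"
proof -
  obtain m where m: "cut_set \<delta> \<subseteq> (\<Union>k\<in>{..m}. W k)" using cut_set_finite(1)[OF assms(1)] by blast
  have "(\<Sum>u\<in>cut_set \<delta>. ratio 1 u powr t) \<le> (\<Sum>u\<in>(\<Union>k\<in>{..m}. W k). ratio 1 u powr t)"
    using m by (intro sum_mono2) auto
  also have "\<dots> = (\<Sum>k\<in>{..m}. level_sum k t)"
    unfolding level_sum_def by (rule sum.UNION_disjoint) (auto dest: length_words[unfolded One_nat_def])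
  also have "\<dots> \<le> (\<Sum>k. level_sum k t)"
    using assms(2) level_sum_pos less_imp_le by (intro sum_le_suminf) auto
  finally show ?thesis .
qed

lemma cut_set_cover:
  assumes "0 < \<delta>" "\<delta> < 1"
  shows "attractor I Js \<subseteq> (\<Union>u\<in>cut_set \<delta>. Js u)"
proof
  fix x assume x: "x \<in> attractor I Js"
  obtain m where m: "c ^ m < \<delta>" using real_arch_pow_inv[OF assms(1) c(2)] by auto
  obtain v where v: "v \<in> W m" "x \<in> Js v" using attractor_cover[OF x] by blast
  let ?P = "\<lambda>j. ratio 1 (take j v) \<le> \<delta>"
  define j where "j = (LEAST j. ?P j)"
  have Pm: "?P m" using ratio_le_power[OF v(1)] m length_words[OF v(1)] by simp
  have "?P j" unfolding j_def by (rule LeastI[of ?P, OF Pm])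
  have "j \<le> m" unfolding j_def by (rule Least_le[of ?P, OF Pm])
  have "j \<noteq> 0" using \<open>?P j\<close> assms(2) ratio_Nil by (intro notI) simp
  then obtain k where k: "j = Suc k" using not0_implies_Suc by blast
  have "\<not> ?P k" using not_less_Least[of k ?P] k unfolding j_def[symmetric] by simp
  then have "take j v \<in> cut_set \<delta>"
    unfolding cut_set_def using \<open>?P j\<close> words_take[OF v(1) \<open>j \<le> m\<close>] k
    by (auto simp: min_def intro!: exI[of _ k])
  moreover have "x \<in> Js (take j v)" using Js_take[OF v(1) \<open>j \<le> m\<close>] v(2) by blast
  ultimately show "x \<in> (\<Union>u\<in>cut_set \<delta>. Js u)" by blast
qed

text \<open>
  A word of the cut set at scale \<open>\<delta>\<close> may overshoot, since its last letter can contract strongly. The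
  hypothesis on the ratios says that this letter costs no more than a small power of the ratio of the
  whole word, so the ratio is at least \<open>\<delta>\<close> up to an arbitrarily small loss in the exponent.
\<close>

lemma cut_set_ratio_ge:
  assumes lim: "(\<lambda>k. ln (min_level_ratio I J \<psi> k) / ln (max_ratio I J \<psi> k)) \<longlonglongrightarrow> 0"
    and "0 < t" "t < T"
  shows "\<exists>d>0. \<forall>\<delta> u. 0 < \<delta> \<longrightarrow> \<delta> < d \<longrightarrow> u \<in> cut_set \<delta> \<longrightarrow> (\<delta> / C) powr T \<le> ratio 1 u powr t"
proof -
  \<comment> \<open>With this loss, \<open>ratio 1 u powr (1 - \<epsilon>)\<close> raised to the power \<open>T\<close> is \<open>ratio 1 u powr t\<close>.\<close>
  define \<epsilon> where "\<epsilon> = 1 - t / T"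
  have \<epsilon>: "0 < \<epsilon>" using assms(2,3) by (simp add: \<epsilon>_def)
  have "eventually (\<lambda>k. ln (min_level_ratio I J \<psi> k) / ln (max_ratio I J \<psi> k) < \<epsilon>) sequentially"
    using lim \<epsilon> by (rule order_tendstoD)
  then obtain k0 where k0: "\<And>k. k \<ge> k0 \<Longrightarrow> ln (min_level_ratio I J \<psi> k) / ln (max_ratio I J \<psi> k) < \<epsilon>"
    unfolding eventually_sequentially by blast
  define F where "F = ratio 1 ` (\<Union>k\<in>{..k0}. W k)"
  have F: "finite F" "F \<noteq> {}" using W_nonempty by (auto simp: F_def)
  have "Min F > 0" using F ratio_pos by (auto simp: F_def)
  moreover have "(\<delta> / C) powr T \<le> ratio 1 u powr t" if \<delta>: "0 < \<delta>" "\<delta> < Min F" and u: "u \<in> cut_set \<delta>" for \<delta> u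
  proof -
    obtain k where k: "u \<in> W (Suc k)" "ratio 1 u \<le> \<delta>" "\<delta> < ratio 1 (take k u)"
      using u by (auto simp: cut_set_def)
    have "Suc k \<ge> k0"
    proof (rule ccontr)
      assume "\<not> ?thesis"
      then have "ratio 1 u \<in> F" using k(1) unfolding F_def by (intro imageI UN_I[of "Suc k"]) auto
      then have "Min F \<le> ratio 1 u" using F(1) by (rule Min_le[rotated])
      then show False using \<delta>(2) k(2) by linarith
    qed
    obtain v i where v: "u = v @ [i]" "v \<in> W k" "i \<in> I (Suc k)" using W_Suc_cases[OF k(1)] .
    have "[i] \<in> words I (Suc k) (Suc k)" using v(3) by (simp add: words_def)
    then have app: "ratio 1 v * ratio (Suc k) [i] \<le> C * ratio 1 u"
      using ratio_append_ge[OF v(2)] v(1) by simp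
    have letter: "ratio 1 u powr \<epsilon> \<le> ratio (Suc k) [i]"
      using k0[OF \<open>Suc k \<ge> k0\<close>] \<epsilon> k(1) v(3) by (intro level_ratio_ge) auto
    have pos: "ratio 1 u > 0" using ratio_pos[OF _ k(1)] by simp
    have "\<delta> * ratio 1 u powr \<epsilon> \<le> ratio 1 v * ratio (Suc k) [i]"
      using k(3) v(1) length_words[OF v(2)] letter \<delta>(1) by (intro mult_mono) auto
    also note app
    finally have "\<delta> / C \<le> ratio 1 u / ratio 1 u powr \<epsilon>"
      using C_ge_1 pos by (simp add: field_simps)
    also have "\<dots> = ratio 1 u powr (1 - \<epsilon>)" using pos by (simp add: powr_diff)
    finally have "(\<delta> / C) powr T \<le> (ratio 1 u powr (1 - \<epsilon>)) powr T"
      using \<delta>(1) C_ge_1 assms(2,3) by (intro powr_mono2) auto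
    also have "\<dots> = ratio 1 u powr t" using assms(2,3) by (simp add: powr_powr \<epsilon>_def)
    finally show ?thesis .
  qed
  ultimately show ?thesis by blast
qed

theorem upper_box_dim_le_pressure_zero:
  assumes lim: "(\<lambda>k. ln (min_level_ratio I J \<psi> k) / ln (max_ratio I J \<psi> k)) \<longlonglongrightarrow> 0"
  shows "upper_box_dim (attractor I Js) \<le> pressure_zero I J \<psi>"
  unfolding pressure_zero_def
proof (rule Inf_greatest, clarify)
  fix t assume t: "upper_pressure I J \<psi> t < 0"
  note t0 = level_sum_summable(1)[OF t] and summable = level_sum_summable(2)[OF t]
  define K where "K = (\<Sum>k. level_sum k t)"
  obtain L where L: "L > 0" "\<And>k u x y. u \<in> W k \<Longrightarrow> x \<in> Js u \<Longrightarrow> y \<in> Js u \<Longrightarrow> dist x y \<le> L * ratio 1 u"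
    using cylinder_diameter by metis
  have main: "upper_box_dim (attractor I Js) \<le> ereal T" if T: "t < T" for T
  proof -
    obtain d where d: "d > 0" "\<And>\<delta> u. 0 < \<delta> \<Longrightarrow> \<delta> < d \<Longrightarrow> u \<in> cut_set \<delta> \<Longrightarrow> (\<delta> / C) powr T \<le> ratio 1 u powr t"
      using cut_set_ratio_ge[OF lim t0 T] by blast
    have "real (covering_number (attractor I Js) \<eta>) \<le> K * (L * C) powr T * \<eta> powr (-T)"
      if \<eta>: "0 < \<eta>" "\<eta> < L * min d 1" for \<eta>
    proof -
      define \<delta> where "\<delta> = \<eta> / L"
      have "\<delta> < min d 1" 
        unfolding \<delta>_def pos_divide_less_eq[OF L(1)] using \<eta>(2) by (simp only: mult.commute)
      then have \<delta>: "0 < \<delta>" "\<delta> < d" "\<delta> < 1" using \<eta>(1) L(1) by (auto simp: \<delta>_def)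
      have fin: "finite (cut_set \<delta>)" using cut_set_finite(2)[OF \<delta>(1)] .
      have "covering_number (attractor I Js) \<eta> \<le> card (Js ` cut_set \<delta>)"
      proof (rule covering_number_le)
        show "finite (Js ` cut_set \<delta>)" using fin by simp
        show "attractor I Js \<subseteq> \<Union>(Js ` cut_set \<delta>)" using cut_set_cover[OF \<delta>(1,3)] .
        fix A assume "A \<in> Js ` cut_set \<delta>"
        then obtain u k where u: "A = Js u" "u \<in> W (Suc k)" "ratio 1 u \<le> \<delta>"
          by (auto simp: cut_set_def)
        have "diameter A \<le> L * ratio 1 u"
          unfolding u(1) using L(2)[OF u(2)] Js_nonempty[OF u(2)] by (intro diameter_le) (auto simp: dist_norm)
        also have "\<dots> \<le> L * \<delta>" using u(3) L(1) by simp
        also have "\<dots> = \<eta>" using L(1) by (simp add: \<delta>_def)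
        finally show "bounded A \<and> diameter A \<le> \<eta>"
          using Js_compact[OF u(2)] u(1) compact_imp_bounded by blast
      qed
      also have "\<dots> \<le> card (cut_set \<delta>)" using fin by (rule card_image_le)
      finally have cov: "real (covering_number (attractor I Js) \<eta>) \<le> real (card (cut_set \<delta>))" by simp
      have "real (card (cut_set \<delta>)) * (\<delta> / C) powr T = (\<Sum>u\<in>cut_set \<delta>. (\<delta> / C) powr T)" by simp
      also have "\<dots> \<le> (\<Sum>u\<in>cut_set \<delta>. ratio 1 u powr t)" using d(2)[OF \<delta>(1,2)] by (rule sum_mono)
      also have "\<dots> \<le> K" unfolding K_def by (rule cut_set_sum_le[OF \<delta>(1) summable])
      finally have "real (card (cut_set \<delta>)) \<le> K / (\<delta> / C) powr T"
        using \<delta>(1) C_ge_1 by (simp add: field_simps)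
      also have "\<dots> = K * (L * C) powr T * \<eta> powr (-T)"
        using L(1) C_ge_1 \<eta>(1) by (simp add: \<delta>_def powr_divide powr_mult powr_minus field_simps)
      finally show ?thesis using cov by linarith
    qed
    moreover have "0 < L * min d 1" using L(1) d(1) by simp
    ultimately have "eventually (\<lambda>\<eta>. real (covering_number (attractor I Js) \<eta>) \<le> K * (L * C) powr T * \<eta> powr (-T)) (at_right 0)"
      unfolding eventually_at_right_0 by blast
    then show ?thesis using t0 T by (intro upper_box_dim_leI) auto
  qed
  show "upper_box_dim (attractor I Js) \<le> ereal t"
  proof (rule ccontr)
    assume "\<not> ?thesis"
    then obtain T where "ereal t < ereal T" "ereal T < upper_box_dim (attractor I Js)"
      using ereal_dense2[of "ereal t"] by (auto simp: not_le)
    then show False using main[of T] by simp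
  qed
qed

end

section \<open>Dimensions of the attractor\<close>

theorem theorem2p2:
  fixes I :: "nat \<Rightarrow> 'i set"
    and J V :: "'a::euclidean_space set"
    and \<phi> \<psi> :: "nat \<Rightarrow> 'i \<Rightarrow> 'a \<Rightarrow> 'a"
    and Js :: "'i list \<Rightarrow> 'a set"
  assumes "nonautonomous_ifs I J \<phi> Js"
    and "conformal_extension I J \<phi> V \<psi>"
    and "open_set_condition I Js"
    and "(\<lambda>k. ln (min_level_ratio I J \<psi> k) / ln (max_ratio I J \<psi> k)) \<longlonglongrightarrow> 0"
  shows "packing_dim (attractor I Js) = upper_box_dim (attractor I Js) \<and>
         upper_box_dim (attractor I Js) = pressure_zero I J \<psi>"
proof -
  obtain c where c: "0 < c" "c < 1"
    "\<And>k i x y. \<lbrakk>k \<ge> 1; i \<in> I k; x \<in> J; y \<in> J\<rbrakk> \<Longrightarrow> norm (\<phi> k i x - \<phi> k i y) \<le> c * norm (x - y)"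
    using nonautonomous_ifs.contraction[OF assms(1)] by (elim exE conjE) (rule that, auto)
  obtain C where C: "C \<ge> 1"
    "\<And>l k u x y. \<lbrakk>1 \<le> l; l \<le> k; u \<in> words I l k; x \<in> V; y \<in> V\<rbrakk> \<Longrightarrow>
      deriv_norm (word_map \<psi> l u) x \<le> C * deriv_norm (word_map \<psi> l u) y"
    using assms(2) unfolding conformal_extension_def by (elim exE conjE) (rule that, auto)
  have V: "open V" "connected V" "J \<subseteq> V"
    and ext: "\<And>k i x. \<lbrakk>k \<ge> 1; i \<in> I k; x \<in> J\<rbrakk> \<Longrightarrow> \<psi> k i x = \<phi> k i x"
    and diff: "\<And>k i. \<lbrakk>k \<ge> 1; i \<in> I k\<rbrakk> \<Longrightarrow> conformal_diffeo_into V (\<psi> k i)"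
    using assms(2) unfolding conformal_extension_def by auto
  interpret conformal_ifs I J \<phi> Js V \<psi> C c
    by (intro conformal_ifs.intro conformal_ifs_axioms.intro assms(1) V ext diff C c)
  show ?thesis
    using pressure_zero_le_packing_dim[OF assms(3)] packing_dim_le_upper_box_dim[OF attractor_bounded]
      upper_box_dim_le_pressure_zero[OF assms(4)]
    by (meson order_antisym order_trans)
qed

end
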